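(* Let $(\mathfrak{M},\Omega,V)$ be a graded von Neumann algebra with modular conjugation $J$. Then there exists a unique maximal central projection $p\in\mathcal{Z}(\mathfrak{M})^\gamma$ with the property that there exists a partial isometry $u_p\in\mathcal{Z}(\mathfrak{M}_p,V_p)$ with $u_p^*u_p=u_pu_p^*=p$. Furthermore, $V_p=u_pJu_pJ$ and $$\mathcal{Z}(\mathfrak{M},V)=\mathcal{Z}(\mathfrak{M}_p,V_p)\oplus\mathcal{Z}(\mathfrak{M}_{p^\perp},V_{p^\perp})=u_p\cdot\mathcal{Z}(\mathfrak{M}_p)\oplus\{0\}.$$
   Context: A graded von Neumann algebra $(\mathfrak{M},\Omega,V)$ consists of a von Neumann algebra $\mathfrak{M}\subset\mathcal{B}(\mathcal{H})$, a cyclic and separating vector $\Omega\in\mathcal{H}$ for $\mathfrak{M}$ with modular data $(J,\Delta)$, and an operator $V\in\mathcal{B}(\mathcal{H})$ with $V=V^*=V^{-1}$, $V\mathfrak{M}V=\mathfrak{M}$ and $V\Omega=\Omega$. $\mathrm{Ad}_V(x)=VxV$. The center of $\mathfrak{M}$ is $\mathcal{Z}(\mathfrak{M})$, and $\mathcal{Z}(\mathfrak{M})^\gamma$ is the set of its $\mathrm{Ad}_V$-invariant elements. The $V$-twisted center is $\mathcal{Z}(\mathfrak{M},V)=\{x\in\mathfrak{M}\;|\;Jx^*J=xV\}$. For a projection $p\in\mathcal{Z}(\mathfrak{M})^\gamma$, put $\mathfrak{M}_p=p\mathfrak{M}p$, $V_p=pVp$, $p^\perp=1-p$; then $(\mathfrak{M}_p,p\Omega,V_p)$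 is a graded von Neumann algebra on $p\mathcal{H}$ (with modular conjugation the restriction of $J$ to $p\mathcal{H}$), and $\mathcal{Z}(\mathfrak{M}_p,V_p)$ is its twisted center; direct sums refer to the decomposition $\mathfrak{M}=\mathfrak{M}_p\oplus\mathfrak{M}_{p^\perp}$. *)

theory Defs
  imports "HOL-Analysis.Analysis"
begin

section \<open>Complex Hilbert spaces and bounded operators\<close>

text \<open>The inner product is antilinear in the first and linear in the second argument; its real
  part is the library's real inner product, so norm, topology and completeness are the
  library's.\<close>

class complex_hilbert = real_inner + complete_space +
  fixes scaleC :: "complex \<Rightarrow> 'a \<Rightarrow> 'a" (infixr "*\<^sub>C" 75)
    and cinner :: "'a \<Rightarrow> 'a \<Rightarrow> complex"
  assumes scaleC_add_right: "c *\<^sub>C (x + y) = c *\<^sub>C x + c *\<^sub>C y"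
    and scaleC_add_left: "(c + d) *\<^sub>C x = c *\<^sub>C x + d *\<^sub>C x"
    and scaleC_scaleC: "c *\<^sub>C d *\<^sub>C x = (c * d) *\<^sub>C x"
    and scaleR_scaleC: "r *\<^sub>R x = complex_of_real r *\<^sub>C x"
    and cinner_commute: "cinner x y = cnj (cinner y x)"
    and cinner_add_right: "cinner x (y + z) = cinner x y + cinner x z"
    and cinner_scaleC_right: "cinner x (c *\<^sub>C y) = c * cinner x y"
    and Re_cinner: "Re (cinner x y) = x \<bullet> y"

text \<open>The type \<open>'a \<Rightarrow>\<^sub>L 'a\<close> consists of the real-linear bounded operators. The algebra
  \<open>B(H)\<close> is the subset of complex-linear ones; the antilinear modular conjugation lives in the
  same type, so that products such as \<open>J x J\<close> are ordinary compositions.\<close>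

definition BH :: "('a::complex_hilbert \<Rightarrow>\<^sub>L 'a) set" where
  "BH = {T :: 'a \<Rightarrow>\<^sub>L 'a. \<forall>c x. T (c *\<^sub>C x) = c *\<^sub>C T x}"

definition antiunitary :: "('a::complex_hilbert \<Rightarrow>\<^sub>L 'a) \<Rightarrow> bool" where
  "antiunitary J \<longleftrightarrow> (\<forall>c x. J (c *\<^sub>C x) = cnj c *\<^sub>C J x) \<and> (\<forall>x. norm (J x) = norm x)
     \<and> surj (blinfun_apply J)"

text \<open>Only meaningful (and only used) on \<^const>\<open>BH\<close>, where it exists by the Riesz
  representation theorem.\<close>

definition adj :: "('a::complex_hilbert \<Rightarrow>\<^sub>L 'a) \<Rightarrow> 'a \<Rightarrow>\<^sub>L 'a" where
  "adj T = (THE S. \<forall>x y. cinner (blinfun_apply S x) y = cinner x (T y))"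

definition is_projection :: "('a::complex_hilbert \<Rightarrow>\<^sub>L 'a) \<Rightarrow> bool" where
  "is_projection p \<longleftrightarrow> p \<in> BH \<and> adj p = p \<and> p o\<^sub>L p = p"

definition projection_le :: "('a::complex_hilbert \<Rightarrow>\<^sub>L 'a) \<Rightarrow> ('a \<Rightarrow>\<^sub>L 'a) \<Rightarrow> bool" where
  "projection_le p q \<longleftrightarrow> range (blinfun_apply p) \<subseteq> range (blinfun_apply q)"

definition partial_isometry :: "('a::complex_hilbert \<Rightarrow>\<^sub>L 'a) \<Rightarrow> bool" where
  "partial_isometry u \<longleftrightarrow> u \<in> BH \<and> u o\<^sub>L adj u o\<^sub>L u = u"


section \<open>Von Neumann algebras\<close>

definition commutant :: "('a::complex_hilbert \<Rightarrow>\<^sub>L 'a) set \<Rightarrow> ('a \<Rightarrow>\<^sub>L 'a) set" where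
  "commutant M = {y \<in> BH. \<forall>x\<in>M. x o\<^sub>L y = y o\<^sub>L x}"

definition von_neumann_algebra :: "('a::complex_hilbert \<Rightarrow>\<^sub>L 'a) set \<Rightarrow> bool" where
  "von_neumann_algebra M \<longleftrightarrow> M \<subseteq> BH \<and> (\<forall>x\<in>M. adj x \<in> M) \<and> commutant (commutant M) = M"

definition center :: "('a::complex_hilbert \<Rightarrow>\<^sub>L 'a) set \<Rightarrow> ('a \<Rightarrow>\<^sub>L 'a) set" where
  "center M = {x \<in> M. \<forall>y\<in>M. x o\<^sub>L y = y o\<^sub>L x}"

definition cyclic_vector :: "('a::complex_hilbert \<Rightarrow>\<^sub>L 'a) set \<Rightarrow> 'a \<Rightarrow> bool" where
  "cyclic_vector M \<Omega> \<longleftrightarrow> closure {blinfun_apply x \<Omega> | x. x \<in> M} = UNIV"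

definition separating_vector :: "('a::complex_hilbert \<Rightarrow>\<^sub>L 'a) set \<Rightarrow> 'a \<Rightarrow> bool" where
  "separating_vector M \<Omega> \<longleftrightarrow> (\<forall>x\<in>M. blinfun_apply x \<Omega> = 0 \<longrightarrow> x = 0)"


section \<open>Modular data\<close>

text \<open>Unbounded operators are represented by their graphs; since relation composition
  \<open>R O S\<close> applies \<open>R\<close> first, the operator product \<open>A B\<close> has graph \<open>B O A\<close>.

  The Tomita operator is the closure of the antilinear operator \<open>x \<Omega> \<mapsto> x\<^sup>* \<Omega>\<close>.\<close>

definition tomita_operator :: "('a::complex_hilbert \<Rightarrow>\<^sub>L 'a) set \<Rightarrow> 'a \<Rightarrow> ('a \<times> 'a) set" where
  "tomita_operator M \<Omega> = closure {(blinfun_apply x \<Omega>, blinfun_apply (adj x) \<Omega>) | x. x \<in> M}"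

definition graph_adjoint :: "('a::complex_hilbert \<times> 'a) set \<Rightarrow> ('a \<times> 'a) set" where
  "graph_adjoint T = {(y, z). \<forall>(x, w)\<in>T. cinner y w = cinner z x}"

text \<open>For antilinear \<open>S\<close> the adjoint is defined by \<open>\<langle>y, S x\<rangle> = \<langle>x, S\<^sup>* y\<rangle>\<close>.\<close>

definition graph_antiadjoint :: "('a::complex_hilbert \<times> 'a) set \<Rightarrow> ('a \<times> 'a) set" where
  "graph_antiadjoint S = {(y, z). \<forall>(x, w)\<in>S. cinner y w = cinner x z}"

text \<open>Density of the domain makes the adjoint relation single-valued, so a relation with this
  property is the graph of an operator, which is closed and complex-linear.\<close>

definition positive_selfadjoint :: "('a::complex_hilbert \<times> 'a) set \<Rightarrow> bool" where
  "positive_selfadjoint T \<longleftrightarrow> closure (Domain T) = UNIV \<and> graph_adjoint T = T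
     \<and> (\<forall>(x, w)\<in>T. cinner x w \<in> \<real>\<^sub>\<ge>\<^sub>0)"

definition modular_operator :: "('a::complex_hilbert \<Rightarrow>\<^sub>L 'a) set \<Rightarrow> 'a \<Rightarrow> ('a \<times> 'a) set" where
  "modular_operator M \<Omega> = tomita_operator M \<Omega> O graph_antiadjoint (tomita_operator M \<Omega>)"

text \<open>The polar decomposition \<open>S = J \<Delta>\<^sup>1\<^sup>/\<^sup>2\<close> of the Tomita operator; \<open>R\<close> is
  the positive square root of the modular operator \<open>\<Delta> = S\<^sup>* S\<close>.\<close>

definition modular_conjugation ::
  "('a::complex_hilbert \<Rightarrow>\<^sub>L 'a) set \<Rightarrow> 'a \<Rightarrow> ('a \<Rightarrow>\<^sub>L 'a) \<Rightarrow> bool" where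
  "modular_conjugation M \<Omega> J \<longleftrightarrow> antiunitary J \<and>
     (\<exists>R. positive_selfadjoint R \<and> R O R = modular_operator M \<Omega>
        \<and> tomita_operator M \<Omega> = {(x, J w) | x w. (x, w) \<in> R})"


section \<open>Graded von Neumann algebras\<close>

definition graded_von_neumann_algebra ::
  "('a::complex_hilbert \<Rightarrow>\<^sub>L 'a) set \<Rightarrow> 'a \<Rightarrow> ('a \<Rightarrow>\<^sub>L 'a) \<Rightarrow> bool" where
  "graded_von_neumann_algebra M \<Omega> V \<longleftrightarrow>
     von_neumann_algebra M \<and> cyclic_vector M \<Omega> \<and> separating_vector M \<Omega>
     \<and> V \<in> BH \<and> adj V = V \<and> V o\<^sub>L V = id_blinfun
     \<and> (\<lambda>x. V o\<^sub>L x o\<^sub>L V) ` M = M \<and> V \<Omega> = \<Omega>"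

definition invariant_center ::
  "('a::complex_hilbert \<Rightarrow>\<^sub>L 'a) set \<Rightarrow> ('a \<Rightarrow>\<^sub>L 'a) \<Rightarrow> ('a \<Rightarrow>\<^sub>L 'a) set" where
  "invariant_center M V = {x \<in> center M. V o\<^sub>L x o\<^sub>L V = x}"

definition twisted_center ::
  "('a::complex_hilbert \<Rightarrow>\<^sub>L 'a) \<Rightarrow> ('a \<Rightarrow>\<^sub>L 'a) set \<Rightarrow> ('a \<Rightarrow>\<^sub>L 'a) \<Rightarrow> ('a \<Rightarrow>\<^sub>L 'a) set" where
  "twisted_center J M V = {x \<in> M. J o\<^sub>L adj x o\<^sub>L J = x o\<^sub>L V}"

text \<open>Operators on \<open>p H\<close> are identified with the operators \<open>x = p x p\<close> on \<open>H\<close>, i.e. they are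
  extended by \<open>0\<close> on the orthogonal complement. The corner of the modular conjugation \<open>J\<close> is
  in this sense the restriction of \<open>J\<close> to \<open>p H\<close>, which is the modular conjugation of the
  corner algebra when \<open>p\<close> is a central projection.\<close>

definition corner :: "('a::complex_hilbert \<Rightarrow>\<^sub>L 'a) \<Rightarrow> ('a \<Rightarrow>\<^sub>L 'a) \<Rightarrow> 'a \<Rightarrow>\<^sub>L 'a" where
  "corner p x = p o\<^sub>L x o\<^sub>L p"

definition corner_twisted_center ::
  "('a::complex_hilbert \<Rightarrow>\<^sub>L 'a) \<Rightarrow> ('a \<Rightarrow>\<^sub>L 'a) set \<Rightarrow> ('a \<Rightarrow>\<^sub>L 'a) \<Rightarrow> ('a \<Rightarrow>\<^sub>L 'a)
     \<Rightarrow> ('a \<Rightarrow>\<^sub>L 'a) set" where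
  "corner_twisted_center J M V p = twisted_center (corner p J) (corner p ` M) (corner p V)"

text \<open>The internal sum of sets of operators; it is direct for subsets of the two corners given by
  \<open>p\<close> and \<open>1 - p\<close>, since \<open>a = p (a + b) p\<close> and \<open>b = (1 - p) (a + b) (1 - p)\<close>.\<close>

definition op_sum ::
  "('a::complex_hilbert \<Rightarrow>\<^sub>L 'a) set \<Rightarrow> ('a \<Rightarrow>\<^sub>L 'a) set \<Rightarrow> ('a \<Rightarrow>\<^sub>L 'a) set" where
  "op_sum A B = {a + b | a b. a \<in> A \<and> b \<in> B}"

text \<open>\<open>u\<close> is a partial isometry in the twisted center of the corner given by \<open>p\<close>, with
  initial and final projection \<open>p\<close>.\<close>

definition twisted_unitary ::
  "('a::complex_hilbert \<Rightarrow>\<^sub>L 'a) \<Rightarrow> ('a \<Rightarrow>\<^sub>L 'a) set \<Rightarrow> ('a \<Rightarrow>\<^sub>L 'a) \<Rightarrow> ('a \<Rightarrow>\<^sub>L 'a)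
     \<Rightarrow> ('a \<Rightarrow>\<^sub>L 'a) \<Rightarrow> bool" where
  "twisted_unitary J M V p u \<longleftrightarrow> partial_isometry u \<and> u \<in> corner_twisted_center J M V p
     \<and> adj u o\<^sub>L u = p \<and> u o\<^sub>L adj u = p"

text \<open>\<open>p\<close> is a projection in the invariant part of the center for which some \<open>u\<close> as above exists.\<close>

definition admissible ::
  "('a::complex_hilbert \<Rightarrow>\<^sub>L 'a) \<Rightarrow> ('a \<Rightarrow>\<^sub>L 'a) set \<Rightarrow> ('a \<Rightarrow>\<^sub>L 'a) \<Rightarrow> ('a \<Rightarrow>\<^sub>L 'a) \<Rightarrow> bool" where
  "admissible J M V p \<longleftrightarrow> is_projection p \<and> p \<in> invariant_center M V
     \<and> (\<exists>u. twisted_unitary J M V p u)"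

definition maximal_admissible ::
  "('a::complex_hilbert \<Rightarrow>\<^sub>L 'a) \<Rightarrow> ('a \<Rightarrow>\<^sub>L 'a) set \<Rightarrow> ('a \<Rightarrow>\<^sub>L 'a) \<Rightarrow> ('a \<Rightarrow>\<^sub>L 'a) \<Rightarrow> bool" where
  "maximal_admissible J M V p \<longleftrightarrow> admissible J M V p
     \<and> (\<forall>q. admissible J M V q \<and> projection_le p q \<longrightarrow> q = p)"

end

theory Submission
  imports Defs
begin

text \<open>Only the part of modular theory that concerns the centralizer of the vector state is needed, and
  it has an elementary proof. For \<open>x\<close> in the centralizer, right multiplication \<open>y \<Omega> \<mapsto> y x\<^sup>* \<Omega>\<close> extends
  to a bounded operator \<open>b\<close> in the commutant; writing the Tomita operator as \<open>J R\<close>, the operator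
  \<open>x - J b J\<close> anticommutes with the positive injective operator \<open>R\<close> and hence vanishes, so
  \<open>J x J \<in> M'\<close>. The defining relation puts the twisted center into the centralizer, which gives
  \<open>y x = x V y V\<close> for \<open>x\<close> in the twisted center and \<open>y \<in> M\<close>. Consequently \<open>x\<^sup>* x = x x\<^sup>*\<close> is central and
  grading invariant, and the polar part of \<open>x\<close> is a partial isometry in the twisted center with
  central support. Such partial isometries can be glued along orthogonal central projections; one
  that maximises \<open>\<parallel>u \<Omega>\<parallel>\<close> has the greatest support \<open>p\<close>, and nothing of the twisted center is left on
  \<open>1 - p\<close>.

  Operators are compared through the real inner product, which treats linear and antilinear
  operators alike.\<close>

section \<open>Adjoints and dense extensions in Hilbert spaces\<close>

text \<open>The twisted center is defined through \<open>J\<close>, and turning that into a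
  statement about products in \<open>M\<close> would normally call for \<open>J M J = M'\<close>.
  That identity is needed only where \<open>R\<close> fixes \<open>x \<Omega>\<close>: if
  \<open>J (adj x) J = x V\<close>, then applying both sides to \<open>\<Omega>\<close>, which
  \<open>V\<close> and \<open>J\<close> fix, gives \<open>J (adj x \<Omega>) = x \<Omega>\<close>,
  and the polar decomposition reads this as \<open>R\<close> fixing \<open>x \<Omega>\<close>. On
  such elements the vector state behaves like a trace, and this is what bounds right multiplication.
  Two polynomial iterations stand in for a functional calculus. \<open>square_remainder\<close>
  expands a positive contraction into squares of polynomials in itself, so that positivity can be
  checked term by term even against an unbounded \<open>R\<close>; \<open>newton_schulz\<close>
  reaches the polar part through products with central elements. Since \<open>\<Omega>\<close> is
  separating, the single number \<open>\<parallel>u \<Omega>\<parallel>\<close> detects whether a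
  support can still grow, so gluing along a sequence is enough and no transfinite exhaustion
  occurs.\<close>

lemma linear_coeff_zero_if_quadratic_nonneg:
  fixes b c :: real
  assumes "\<And>t. 2 * t * b + t\<^sup>2 * c \<ge> 0"
  shows "b = 0"
proof (rule ccontr)
  assume b: "b \<noteq> 0"
  define k where "k = \<bar>c\<bar> + 1"
  have k: "k > 0" "c - 2 * k < 0" unfolding k_def by (auto simp: abs_if)
  \<comment> \<open>At \<open>t = - b / k\<close> the linear term outweighs the quadratic one,
    because \<open>k\<close> exceeds the modulus of \<open>c\<close>.\<close>
  have "2 * (- b / k) * b + (- b / k)\<^sup>2 * c = b\<^sup>2 * (c - 2 * k) / k\<^sup>2"
    using k(1) by (simp add: field_simps power2_eq_square)
  moreover have "b\<^sup>2 * (c - 2 * k) / k\<^sup>2 < 0"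
    using k b by (simp add: divide_neg_pos mult_pos_neg)
  ultimately show False using assms[of "- b / k"] by linarith
qed

text \<open>The representing vector is the minimiser of \<open>x \<bullet> x - 2 * f x\<close>. The
  parallelogram law, in which the linear part cancels, makes a minimising sequence Cauchy; the
  vanishing first variation at its limit is the claim.\<close>

lemma riesz_representation:
  fixes f :: "'a::{real_inner,complete_space} \<Rightarrow> real"
  assumes f: "bounded_linear f"
  shows "\<exists>a. \<forall>x. f x = a \<bullet> x"
proof -
  interpret bounded_linear f by fact
  obtain N where N: "\<And>x. norm (f x) \<le> norm x * N" using bounded by blast
  define g where "g x = x \<bullet> x - 2 * f x" for x
  have g_lower: "- (N\<^sup>2) \<le> g x" for x
  proof -
    have "f x \<le> norm x * N" using N[of x] by auto
    moreover have "0 \<le> (norm x - N)\<^sup>2" by simp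
    ultimately show ?thesis
      unfolding g_def by (simp add: power2_diff power2_norm_eq_inner mult.commute)
  qed
  define m where "m = Inf (range g)"
  have bdd: "bdd_below (range g)" using g_lower by (auto intro!: bdd_belowI)
  have m: "m \<le> g x" for x unfolding m_def using bdd by (simp add: cInf_lower)
  have "\<exists>x. g x < m + 1 / real (Suc n)" for n
    using cInf_lessD[of "range g" "m + 1 / real (Suc n)"] unfolding m_def by auto
  then obtain X where X: "\<And>n. g (X n) < m + 1 / real (Suc n)" by metis
  have mid: "(norm (x - y))\<^sup>2 = 2 * g x + 2 * g y - 4 * g ((1/2) *\<^sub>R (x + y))" for x y
    unfolding g_def power2_norm_eq_inner scaleR add
    by (simp add: inner_simps inner_commute algebra_simps)
  have dist_X: "(norm (X i - X j))\<^sup>2 \<le> 4 / real (Suc n)" if "i \<ge> n" "j \<ge> n" for i j n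
  proof -
    have "1 / real (Suc i) \<le> 1 / real (Suc n)" "1 / real (Suc j) \<le> 1 / real (Suc n)"
      using that by (auto simp: frac_le)
    then have "g (X i) < m + 1 / real (Suc n)" "g (X j) < m + 1 / real (Suc n)"
      using X[of i] X[of j] by linarith+
    then show ?thesis
      using mid[of "X i" "X j"] m[of "(1/2) *\<^sub>R (X i + X j)"] by simp
  qed
  have "Cauchy X"
  proof (rule metric_CauchyI)
    fix e :: real assume e: "e > 0"
    then obtain n where n: "4 / e\<^sup>2 < real n" using reals_Archimedean2 by blast
    have "4 / real (Suc n) < e\<^sup>2" using n e by (simp add: field_simps) (simp add: add_strict_increasing)
    then have "\<forall>i\<ge>n. \<forall>j\<ge>n. (norm (X i - X j))\<^sup>2 < e\<^sup>2" using dist_X by fastforce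
    then show "\<exists>n. \<forall>i\<ge>n. \<forall>j\<ge>n. dist (X i) (X j) < e"
      using e by (metis dist_norm less_eq_real_def power2_less_imp_less)
  qed
  then obtain a where a: "X \<longlonglongrightarrow> a" using Cauchy_convergent convergent_def by blast
  have "(\<lambda>n. g (X n)) \<longlonglongrightarrow> g a"
    unfolding g_def by (intro tendsto_intros a tendsto)
  moreover have "(\<lambda>n. m + 1 / real (Suc n)) \<longlonglongrightarrow> m + 0"
    by (intro tendsto_intros LIMSEQ_Suc[OF lim_1_over_n])
  ultimately have ga: "g a \<le> m + 0"
    using X by (intro LIMSEQ_le[of _ "g a" _ "m + 0"]) (auto intro: less_imp_le)
  have "f y = a \<bullet> y" for y
  proof -
    have "2 * t * (a \<bullet> y - f y) + t\<^sup>2 * (y \<bullet> y) \<ge> 0" for t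
    proof -
      have "g a \<le> g (a + t *\<^sub>R y)" using ga m[of "a + t *\<^sub>R y"] by simp
      then show ?thesis unfolding g_def add scaleR
        by (simp add: inner_simps inner_commute algebra_simps power2_eq_square)
    qed
    from linear_coeff_zero_if_quadratic_nonneg[OF this] show ?thesis by simp
  qed
  then show ?thesis by blast
qed

lemma eq_if_inner_eq:
  fixes a b :: "'a::real_inner"
  assumes "\<And>y. a \<bullet> y = b \<bullet> y"
  shows "a = b"
  using assms[of "a - b"] by (metis inner_diff_left inner_eq_zero_iff right_minus_eq)

lemma eq_if_inner_eq_dense:
  fixes a b :: "'a::real_inner"
  assumes "closure D = UNIV" and eq: "\<And>y. y \<in> D \<Longrightarrow> a \<bullet> y = b \<bullet> y"
  shows "a = b"
proof (rule eq_if_inner_eq)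
  fix y
  have "closed {y. a \<bullet> y = b \<bullet> y}" by (intro closed_Collect_eq continuous_intros)
  moreover have "D \<subseteq> {y. a \<bullet> y = b \<bullet> y}" using eq by blast
  ultimately have "closure D \<subseteq> {y. a \<bullet> y = b \<bullet> y}" by (simp add: closure_minimal)
  then show "a \<bullet> y = b \<bullet> y" using assms(1) by blast
qed

lemma blinfun_eq_on_dense:
  fixes S T :: "'a::real_normed_vector \<Rightarrow>\<^sub>L 'b::real_normed_vector"
  assumes "closure D = UNIV" and eq: "\<And>y. y \<in> D \<Longrightarrow> S y = T y"
  shows "S = T"
proof (rule blinfun_eqI)
  fix y
  have "closed {y. S y = T y}" by (intro closed_Collect_eq continuous_intros)
  moreover have "D \<subseteq> {y. S y = T y}" using eq by blast
  ultimately have "closure D \<subseteq> {y. S y = T y}" by (simp add: closure_minimal)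
  then show "S y = T y" using assms(1) by blast
qed

text \<open>Adjoints over the reals are available also for the antilinear \<open>J\<close>, and for
  right multiplications without a proof of complex linearity.\<close>

lemma real_adjoint_exists:
  fixes T :: "'a::{real_inner,complete_space} \<Rightarrow>\<^sub>L 'a"
  shows "\<exists>S :: 'a \<Rightarrow>\<^sub>L 'a. \<forall>x y. S x \<bullet> y = x \<bullet> T y"
proof -
  have "\<exists>a. \<forall>y. x \<bullet> T y = a \<bullet> y" for x
    by (rule riesz_representation)
       (intro bounded_linear_compose[OF bounded_linear_inner_right] blinfun.bounded_linear_right)
  then obtain S where S: "\<And>x y. x \<bullet> T y = S x \<bullet> y" by metis
  have "bounded_linear S"
  proof (rule bounded_linear_intro)
    fix x y :: 'a and r :: real
    show "S (x + y) = S x + S y"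
      by (rule eq_if_inner_eq) (simp add: inner_simps flip: S)
    show "S (r *\<^sub>R x) = r *\<^sub>R S x"
      by (rule eq_if_inner_eq) (simp add: inner_simps flip: S)
    have "norm (S x) * norm (S x) = x \<bullet> T (S x)"
      by (simp add: S flip: power2_norm_eq_inner power2_eq_square)
    also have "\<dots> \<le> norm x * norm (T (S x))" by (rule norm_cauchy_schwarz)
    also have "\<dots> \<le> norm x * (norm T * norm (S x))"
      by (intro mult_left_mono norm_blinfun) simp
    finally have "norm (S x) * norm (S x) \<le> (norm x * norm T) * norm (S x)" by (simp add: mult_ac)
    then show "norm (S x) \<le> norm x * norm T"
      by (cases "S x = 0") (auto simp: mult_le_cancel_right)
  qed
  then have "\<forall>x y. Blinfun S x \<bullet> y = x \<bullet> T y" by (simp add: S bounded_linear_Blinfun_apply)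
  then show ?thesis by blast
qed

lemma dense_linear_extension:
  fixes f :: "'a::real_normed_vector \<Rightarrow> 'b::{real_normed_vector,complete_space}"
  assumes D: "subspace D" "closure D = UNIV"
    and add: "\<And>x y. x \<in> D \<Longrightarrow> y \<in> D \<Longrightarrow> f (x + y) = f x + f y"
    and scale: "\<And>r x. x \<in> D \<Longrightarrow> f (r *\<^sub>R x) = r *\<^sub>R f x"
    and bound: "\<And>x. x \<in> D \<Longrightarrow> norm (f x) \<le> C * norm x"
  shows "\<exists>T :: 'a \<Rightarrow>\<^sub>L 'b. \<forall>x\<in>D. T x = f x"
proof -
  have diff: "f x - f y = f (x - y)" if "x \<in> D" "y \<in> D" for x y
    using add[of x "- 1 *\<^sub>R y"] scale[of y "-1"] that subspace_scale[OF D(1), of y "-1"] by simp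
  have "uniformly_continuous_on D f"
    unfolding uniformly_continuous_on_def
  proof (intro allI impI)
    fix e :: real assume e: "e > 0"
    show "\<exists>d>0. \<forall>x\<in>D. \<forall>x'\<in>D. dist x' x < d \<longrightarrow> dist (f x') (f x) < e"
    proof (intro exI[of _ "e / (\<bar>C\<bar> + 1)"] conjI ballI impI)
      fix x y assume xy: "x \<in> D" "y \<in> D" "dist y x < e / (\<bar>C\<bar> + 1)"
      have "dist (f y) (f x) \<le> C * norm (y - x)"
        using bound[of "y - x"] xy subspace_diff[OF D(1)] by (simp add: dist_norm diff)
      also have "\<dots> \<le> (\<bar>C\<bar> + 1) * norm (y - x)" by (intro mult_right_mono) auto
      also have "\<dots> < e" using xy(3) by (simp add: dist_norm field_simps)
      finally show "dist (f y) (f x) < e" .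
    qed (use e in auto)
  qed
  then obtain g where g: "uniformly_continuous_on (closure D) g" "\<And>x. x \<in> D \<Longrightarrow> f x = g x"
    using uniformly_continuous_on_extension_on_closure by metis
  have cont: "continuous_on UNIV g" using g(1) D(2) uniformly_continuous_imp_continuous by metis
  have cg: "continuous_on UNIV (\<lambda>x. g (h x))" if "continuous_on UNIV h" for h :: "'c::topological_space \<Rightarrow> 'a"
    using continuous_on_compose2[OF cont that] by simp
  have "bounded_linear g"
  proof (rule bounded_linear_intro)
    fix x y :: 'a and r :: real
    have "closed {z. g (fst z + snd z) = g (fst z) + g (snd z)}"
      by (intro closed_Collect_eq cg continuous_intros)
    moreover have "D \<times> D \<subseteq> {z. g (fst z + snd z) = g (fst z) + g (snd z)}"
      using add g(2) subspace_add[OF D(1)] by fastforce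
    ultimately have "closure (D \<times> D) \<subseteq> {z. g (fst z + snd z) = g (fst z) + g (snd z)}"
      by (simp add: closure_minimal)
    then show "g (x + y) = g x + g y" using D(2) by (auto simp: closure_Times subset_iff)
    have "closed {z. g (r *\<^sub>R z) = r *\<^sub>R g z}"
      by (intro closed_Collect_eq cg continuous_intros)
    moreover have "D \<subseteq> {z. g (r *\<^sub>R z) = r *\<^sub>R g z}"
      using scale g(2) subspace_scale[OF D(1)] by fastforce
    ultimately have "closure D \<subseteq> {z. g (r *\<^sub>R z) = r *\<^sub>R g z}" by (simp add: closure_minimal)
    then show "g (r *\<^sub>R x) = r *\<^sub>R g x" using D(2) by auto
    have "closed {z. norm (g z) \<le> C * norm z}"
      by (intro closed_Collect_le cg continuous_intros)
    moreover have "D \<subseteq> {z. norm (g z) \<le> C * norm z}"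
      using bound g(2) by auto
    ultimately have "closure D \<subseteq> {z. norm (g z) \<le> C * norm z}" by (simp add: closure_minimal)
    then show "norm (g x) \<le> norm x * C" using D(2) by (auto simp: mult.commute)
  qed
  then have "\<forall>x\<in>D. Blinfun g x = f x" using g(2) by (simp add: bounded_linear_Blinfun_apply)
  then show ?thesis by blast
qed

section \<open>Positive operators\<close>

text \<open>The recursion of F. Riesz behind the theorem that commuting positive operators have a
  positive product. It telescopes into a sum of squares of polynomials in \<open>e\<close> and does
  the work of a square root.\<close>

primrec square_remainder :: "('a::real_normed_vector \<Rightarrow>\<^sub>L 'a) \<Rightarrow> nat \<Rightarrow> 'a \<Rightarrow>\<^sub>L 'a" where
  "square_remainder e 0 = e"
| "square_remainder e (Suc n) =
     square_remainder e n - (square_remainder e n o\<^sub>L square_remainder e n)"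

lemma square_remainder_sum:
  fixes e :: "'a::real_normed_vector \<Rightarrow>\<^sub>L 'a"
  shows "e x = (\<Sum>k<n. square_remainder e k (square_remainder e k x)) + square_remainder e n x"
  by (induction n) (auto simp: blinfun.bilinear_simps)

definition positive_contraction :: "('a::real_inner \<Rightarrow>\<^sub>L 'a) \<Rightarrow> bool" where
  "positive_contraction e \<longleftrightarrow>
     (\<forall>x y. e x \<bullet> y = x \<bullet> e y) \<and> (\<forall>x. 0 \<le> x \<bullet> e x \<and> x \<bullet> e x \<le> x \<bullet> x)"

text \<open>Positivity rests on \<open>f - f\<^sup>2 = f (1 - f) f + (1 - f) f (1 - f)\<close>; the
  upper bound comes from dropping the square.\<close>

lemma positive_contraction_diff_square:
  fixes f :: "'a::real_inner \<Rightarrow>\<^sub>L 'a"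
  assumes f: "positive_contraction f"
  shows "positive_contraction (f - (f o\<^sub>L f))"
proof -
  have sym: "f x \<bullet> y = x \<bullet> f y" and pos: "0 \<le> x \<bullet> f x" and le: "x \<bullet> f x \<le> x \<bullet> x" for x y
    using f unfolding positive_contraction_def by auto
  have "x \<bullet> (f x - f (f x)) = (f x \<bullet> f x - f x \<bullet> f (f x)) + (x - f x) \<bullet> f (x - f x)" for x
    by (simp add: inner_simps blinfun.bilinear_simps sym)
  moreover have "(f x \<bullet> f x - f x \<bullet> f (f x)) + (x - f x) \<bullet> f (x - f x) \<ge> 0" for x
    using le[of "f x"] pos[of "x - f x"] by simp
  moreover have "x \<bullet> (f x - f (f x)) \<le> x \<bullet> x" for x
    using le[of x] inner_ge_zero[of "f x"] by (simp add: inner_simps sym)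
  ultimately show ?thesis
    unfolding positive_contraction_def
    by (simp add: blinfun.bilinear_simps inner_simps sym)
qed

lemma positive_contraction_square_remainder:
  "positive_contraction e \<Longrightarrow> positive_contraction (square_remainder e n)"
  by (induction n) (auto intro: positive_contraction_diff_square)

text \<open>Testing the expansion of \<open>e\<close> at \<open>x\<close> bounds the sum of the
  squared norms of the remainders by \<open>x \<bullet> e x\<close>, so the terms of that series
  vanish in the limit.\<close>

lemma square_remainder_tendsto_0:
  fixes e :: "'a::real_inner \<Rightarrow>\<^sub>L 'a"
  assumes e: "positive_contraction e"
  shows "(\<lambda>n. square_remainder e n x) \<longlonglongrightarrow> 0"
proof -
  let ?f = "square_remainder e"
  have sym: "?f n x \<bullet> y = x \<bullet> ?f n y" and pos: "0 \<le> x \<bullet> ?f n x" for x y n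
    using positive_contraction_square_remainder[OF e] unfolding positive_contraction_def by auto
  have "(\<Sum>k<n. (norm (?f k x))\<^sup>2) \<le> x \<bullet> e x" for n
  proof -
    have "x \<bullet> e x = (\<Sum>k<n. x \<bullet> ?f k (?f k x)) + x \<bullet> ?f n x"
      by (subst square_remainder_sum[of e x n]) (simp add: inner_simps inner_sum_right)
    then show ?thesis using pos[of x n] by (simp add: power2_norm_eq_inner sym)
  qed
  then have "summable (\<lambda>k. (norm (?f k x))\<^sup>2)"
    by (intro summableI_nonneg_bounded) auto
  then have "(\<lambda>k. (norm (?f k x))\<^sup>2) \<longlonglongrightarrow> 0" by (rule summable_LIMSEQ_zero)
  then have "(\<lambda>k. sqrt ((norm (?f k x))\<^sup>2)) \<longlonglongrightarrow> sqrt 0" by (intro tendsto_intros)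
  then show ?thesis by (simp add: tendsto_norm_zero_iff)
qed

text \<open>With \<open>e = (\<Sum>k<n. f\<^sub>k\<^sup>2) + f\<^sub>n\<close> the form splits into the terms \<open>\<langle>f\<^sub>k x, R f\<^sub>k x\<rangle>\<close>
  and a remainder that tends to \<open>0\<close>.\<close>

lemma commuting_positive_form:
  fixes e :: "'a::real_inner \<Rightarrow>\<^sub>L 'a"
  assumes e: "positive_contraction e"
    and diff: "\<And>x w y v. (x, w) \<in> R \<Longrightarrow> (y, v) \<in> R \<Longrightarrow> (x - y, w - v) \<in> R"
    and positive: "\<And>x w. (x, w) \<in> R \<Longrightarrow> 0 \<le> x \<bullet> w"
    and comm: "\<And>x w. (x, w) \<in> R \<Longrightarrow> (e x, e w) \<in> R"
    and xw: "(x, w) \<in> R"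
  shows "0 \<le> e x \<bullet> w"
proof -
  let ?f = "square_remainder e"
  have sym: "?f n x \<bullet> y = x \<bullet> ?f n y" for x y n
    using positive_contraction_square_remainder[OF e] unfolding positive_contraction_def by auto
  have f_comm: "(x, w) \<in> R \<Longrightarrow> (?f n x, ?f n w) \<in> R" for x w n
    by (induction n arbitrary: x w) (auto simp: blinfun.bilinear_simps intro: comm diff)
  have "?f n x \<bullet> w \<le> e x \<bullet> w" for n
  proof -
    have "e x \<bullet> w = (\<Sum>k<n. ?f k x \<bullet> ?f k w) + ?f n x \<bullet> w"
      by (subst square_remainder_sum[of e x n]) (simp add: inner_simps inner_sum_left sym)
    moreover have "0 \<le> ?f k x \<bullet> ?f k w" for k using positive[OF f_comm[OF xw]] .
    ultimately show ?thesis by (simp add: sum_nonneg)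
  qed
  moreover have "(\<lambda>n. ?f n x \<bullet> w) \<longlonglongrightarrow> 0 \<bullet> w"
    by (intro tendsto_intros square_remainder_tendsto_0 e)
  ultimately show ?thesis by (intro LIMSEQ_le_const2[of _ "0"]) auto
qed

text \<open>Only the real Hilbert space structure enters, so the bounded operators compared with
  \<open>R\<close> need be neither complex-linear nor antilinear. Linearity of \<open>R\<close> is
  contained in \<open>selfadjoint\<close>, because an adjoint relation is a subspace.\<close>

locale positive_selfadjoint_relation =
  fixes R :: "('a::{real_inner,complete_space} \<times> 'a) set"
  assumes dense: "closure (Domain R) = UNIV"
    and selfadjoint: "(x, w) \<in> R \<longleftrightarrow> (\<forall>(a, b)\<in>R. x \<bullet> b = w \<bullet> a)"
    and positive: "(x, w) \<in> R \<Longrightarrow> 0 \<le> x \<bullet> w"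
    and injective: "(x, 0) \<in> R \<Longrightarrow> x = 0"
begin

lemma relI: "(\<And>a b. (a, b) \<in> R \<Longrightarrow> x \<bullet> b = w \<bullet> a) \<Longrightarrow> (x, w) \<in> R"
  using selfadjoint by blast

lemma symmetric: "(x, w) \<in> R \<Longrightarrow> (a, b) \<in> R \<Longrightarrow> x \<bullet> b = w \<bullet> a"
  using selfadjoint by blast

lemma rel_add: "(x, w) \<in> R \<Longrightarrow> (y, v) \<in> R \<Longrightarrow> (x + y, w + v) \<in> R"
  by (rule relI) (simp add: inner_simps, metis symmetric)

lemma rel_diff: "(x, w) \<in> R \<Longrightarrow> (y, v) \<in> R \<Longrightarrow> (x - y, w - v) \<in> R"
  by (rule relI) (simp add: inner_simps, metis symmetric)

lemma rel_scale: "(x, w) \<in> R \<Longrightarrow> (r *\<^sub>R x, r *\<^sub>R w) \<in> R"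
  by (rule relI) (simp add: inner_simps, metis symmetric)

text \<open>The degenerate case of Cauchy-Schwarz for the form of \<open>R\<close>: perturbing
  \<open>v\<close> along the domain shows that \<open>r\<close> is orthogonal to a dense set, and
  injectivity does the rest.\<close>

lemma null_form_imp_zero:
  assumes "(v, r) \<in> R" "v \<bullet> r = 0"
  shows "v = 0"
proof -
  have "r = 0"
  proof (rule eq_if_inner_eq_dense[OF dense])
    fix a assume "a \<in> Domain R"
    then obtain b where ab: "(a, b) \<in> R" by auto
    have "0 \<le> 2 * t * (r \<bullet> a) + t\<^sup>2 * (a \<bullet> b)" for t
      using positive[OF rel_add[OF assms(1) rel_scale[OF ab, of t]]] assms(2)
        symmetric[OF assms(1) ab]
      by (simp add: inner_simps inner_commute[of a r] power2_eq_square algebra_simps)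
    from linear_coeff_zero_if_quadratic_nonneg[OF this] show "r \<bullet> a = 0 \<bullet> a" by simp
  qed
  then show ?thesis using injective assms(1) by simp
qed

text \<open>Two signs collide. \<open>d' d\<close> commutes with \<open>R\<close>, so
  \<open>d x \<bullet> d w\<close> is nonnegative; but \<open>R\<close> takes \<open>d x\<close> to
  \<open>- d w\<close>, so it is also nonpositive. The form of \<open>R\<close> therefore vanishes
  at \<open>d x\<close>.\<close>

lemma anticommuting_zero:
  fixes d d' :: "'a \<Rightarrow>\<^sub>L 'a"
  assumes adj: "\<And>x y. d' x \<bullet> y = x \<bullet> d y"
    and d: "\<And>x w. (x, w) \<in> R \<Longrightarrow> (d x, - d w) \<in> R"
    and d': "\<And>x w. (x, w) \<in> R \<Longrightarrow> (d' x, - d' w) \<in> R"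
  shows "d = 0"
proof (rule blinfun_eq_on_dense[OF dense])
  fix x assume "x \<in> Domain R"
  then obtain w where xw: "(x, w) \<in> R" by auto
  \<comment> \<open>The factor scales \<open>d' d\<close> to a contraction; the summand
    \<open>1\<close> covers \<open>d = 0\<close>.\<close>
  define c where "c = 1 / ((norm d)\<^sup>2 + 1)"
  define e where "e = c *\<^sub>R (d' o\<^sub>L d)"
  have adj': "d x \<bullet> y = x \<bullet> d' y" for x y
    using adj[of y x] by (simp add: inner_commute)
  have c: "0 < c" "c * (norm d)\<^sup>2 \<le> 1"
    unfolding c_def by (auto simp: field_simps add_pos_nonneg intro!: divide_pos_pos)
  have "positive_contraction e"
    unfolding positive_contraction_def
  proof (intro conjI allI)
    fix x y
    show "e x \<bullet> y = x \<bullet> e y" unfolding e_def by (simp add: blinfun.bilinear_simps adj adj')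
    have *: "x \<bullet> e x = c * (norm (d x))\<^sup>2"
      unfolding e_def by (simp add: blinfun.bilinear_simps adj' power2_norm_eq_inner flip: adj')
    show "0 \<le> x \<bullet> e x" unfolding * using c by simp
    have "(norm (d x))\<^sup>2 \<le> (norm d * norm x)\<^sup>2" by (intro power_mono norm_blinfun) simp
    then have "c * (norm (d x))\<^sup>2 \<le> (c * (norm d)\<^sup>2) * (norm x)\<^sup>2"
      using c(1) by (simp add: power_mult_distrib mult.assoc)
    also have "\<dots> \<le> 1 * (norm x)\<^sup>2" by (intro mult_right_mono c) simp
    finally show "x \<bullet> e x \<le> x \<bullet> x" unfolding * by (simp add: power2_norm_eq_inner)
  qed
  moreover have "(e x, e w) \<in> R" if "(x, w) \<in> R" for x w
    using rel_scale[OF d'[OF d[OF that]], of c] unfolding e_def by (simp add: blinfun.bilinear_simps)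
  ultimately have "0 \<le> e x \<bullet> w" using commuting_positive_form[of e R x w] rel_diff positive xw by blast
  then have "0 \<le> d x \<bullet> d w"
    using c unfolding e_def by (simp add: blinfun.bilinear_simps adj zero_le_mult_iff)
  moreover have "0 \<le> d x \<bullet> - d w" by (rule positive[OF d[OF xw]])
  ultimately have "d x \<bullet> - d w = 0" by simp
  then have "d x = 0" using null_form_imp_zero[OF d[OF xw]] by blast
  then show "d x = (0::'a \<Rightarrow>\<^sub>L 'a) x" by simp
qed

end

section \<open>Modular conjugation\<close>

lemma cinner_scaleC_left: "cinner (c *\<^sub>C x) y = cnj c * cinner x y"
  for x y :: "'a::complex_hilbert"
  by (metis cinner_commute cinner_scaleC_right complex_cnj_mult complex_cnj_cnj)

lemma inner_scaleC_left: "(c *\<^sub>C x) \<bullet> y = x \<bullet> (cnj c *\<^sub>C y)"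
  for x y :: "'a::complex_hilbert"
  by (simp add: cinner_scaleC_left cinner_scaleC_right flip: Re_cinner)

lemma Im_cinner: "Im (cinner x y) = (\<i> *\<^sub>C x) \<bullet> y"
  for x y :: "'a::complex_hilbert"
  by (simp add: cinner_scaleC_left flip: Re_cinner)

lemma scaleC_scaleR: "c *\<^sub>C (r *\<^sub>R x) = r *\<^sub>R (c *\<^sub>C x)"
  for x :: "'a::complex_hilbert"
  by (simp add: scaleR_scaleC scaleC_scaleC mult.commute)

lemma scaleC_minus_right: "c *\<^sub>C (- x) = - (c *\<^sub>C x)"
  for x :: "'a::complex_hilbert"
  using scaleC_scaleR[of c "-1" x] by simp

lemma scaleC_diff_right: "c *\<^sub>C (x - y) = c *\<^sub>C x - c *\<^sub>C y"
  for x :: "'a::complex_hilbert"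
  using scaleC_add_right[of c x "- y"] by (simp add: scaleC_minus_right)

lemma tendsto_scaleC:
  fixes f :: "'b \<Rightarrow> 'a::complex_hilbert"
  assumes "(f \<longlongrightarrow> l) F"
  shows "((\<lambda>n. c *\<^sub>C f n) \<longlongrightarrow> c *\<^sub>C l) F"
proof -
  have "bounded_linear (\<lambda>x::'a. c *\<^sub>C x)"
  proof (rule bounded_linear_intro)
    fix x :: 'a
    have "(c *\<^sub>C x) \<bullet> (c *\<^sub>C x) = (cmod c)\<^sup>2 * (x \<bullet> x)"
      unfolding inner_scaleC_left scaleC_scaleC
      by (metis complex_norm_square inner_scaleR_right mult.commute scaleR_scaleC)
    then have "(norm (c *\<^sub>C x))\<^sup>2 = (norm x * cmod c)\<^sup>2"
      by (simp add: power2_norm_eq_inner power_mult_distrib mult.commute)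
    then show "norm (c *\<^sub>C x) \<le> norm x * cmod c" by simp
  qed (simp_all add: scaleC_add_right scaleC_scaleR)
  then show ?thesis by (rule bounded_linear.tendsto[OF _ assms])
qed

lemma blinfun_eq_iff: "S = T \<longleftrightarrow> (\<forall>x. blinfun_apply S x = blinfun_apply T x)"
  by (auto intro: blinfun_eqI)

text \<open>The real adjoint of a complex-linear operator is complex-linear by uniqueness, and
  inserting the scalar \<open>\<i>\<close> recovers the imaginary part of the complex adjoint
  identity; so it is the operator that \<open>adj\<close> describes.\<close>

lemma BH_adjoint:
  fixes T :: "'a::complex_hilbert \<Rightarrow>\<^sub>L 'a"
  assumes T: "T \<in> BH"
  shows "adj T \<in> BH" and "adj T x \<bullet> y = x \<bullet> T y"
proof -
  obtain S :: "'a \<Rightarrow>\<^sub>L 'a" where S: "\<And>x y. S x \<bullet> y = x \<bullet> T y"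
    using real_adjoint_exists by blast
  have TC: "T (c *\<^sub>C x) = c *\<^sub>C T x" for c x using T unfolding BH_def by auto
  have SC: "S (c *\<^sub>C x) = c *\<^sub>C S x" for c x
    by (rule eq_if_inner_eq) (simp add: S inner_scaleC_left TC)
  have cin: "cinner (S x) y = cinner x (T y)" for x y
    by (rule complex_eqI) (simp_all add: Re_cinner Im_cinner S flip: SC)
  have "adj T = S"
    unfolding adj_def
  proof (rule the_equality)
    fix S' :: "'a \<Rightarrow>\<^sub>L 'a" assume S': "\<forall>x y. cinner (S' x) y = cinner x (T y)"
    show "S' = S"
      by (rule blinfun_eqI, rule eq_if_inner_eq) (metis S S' Re_cinner)
  qed (use cin in blast)
  then show "adj T \<in> BH" "adj T x \<bullet> y = x \<bullet> T y" using S SC unfolding BH_def by auto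
qed

lemma BH_adjoint_right: "T \<in> BH \<Longrightarrow> x \<bullet> adj T y = T x \<bullet> y"
  using BH_adjoint(2)[of T y x] by (simp add: inner_commute)

lemma adj_eqI:
  fixes S T :: "'a::complex_hilbert \<Rightarrow>\<^sub>L 'a"
  assumes "T \<in> BH" "\<And>x y. S x \<bullet> y = x \<bullet> T y"
  shows "adj T = S"
  by (rule blinfun_eqI, rule eq_if_inner_eq) (simp add: assms BH_adjoint)

lemma BH_compose: "S \<in> BH \<Longrightarrow> T \<in> BH \<Longrightarrow> S o\<^sub>L T \<in> BH"
  and BH_add: "S \<in> BH \<Longrightarrow> T \<in> BH \<Longrightarrow> S + T \<in> BH"
  and BH_diff: "S \<in> BH \<Longrightarrow> T \<in> BH \<Longrightarrow> S - T \<in> BH"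
  and BH_scale: "T \<in> BH \<Longrightarrow> r *\<^sub>R T \<in> BH"
  and BH_id: "id_blinfun \<in> BH"
  unfolding BH_def
  by (simp_all add: blinfun.bilinear_simps scaleC_add_right scaleC_diff_right scaleC_scaleR)

lemma adj_adj: "T \<in> BH \<Longrightarrow> adj (adj T) = T"
  by (intro adj_eqI BH_adjoint) (simp_all add: BH_adjoint_right)

lemma adj_compose: "S \<in> BH \<Longrightarrow> T \<in> BH \<Longrightarrow> adj (S o\<^sub>L T) = adj T o\<^sub>L adj S"
  and adj_add: "S \<in> BH \<Longrightarrow> T \<in> BH \<Longrightarrow> adj (S + T) = adj S + adj T"
  and adj_diff: "S \<in> BH \<Longrightarrow> T \<in> BH \<Longrightarrow> adj (S - T) = adj S - adj T"
  and adj_scale: "T \<in> BH \<Longrightarrow> adj (r *\<^sub>R T) = r *\<^sub>R adj T"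
  and adj_id: "adj id_blinfun = id_blinfun"
  by (rule adj_eqI, simp_all add: BH_compose BH_add BH_diff BH_scale BH_id BH_adjoint
      blinfun.bilinear_simps inner_simps)+

text \<open>An adjoint relation is invariant under complex scalars, so the real condition, tested on
  a pair multiplied by \<open>- \<i>\<close>, supplies the imaginary part.\<close>

lemma positive_selfadjoint_inner_iff:
  assumes "positive_selfadjoint R"
  shows "(x, w) \<in> R \<longleftrightarrow> (\<forall>(a, b)\<in>R. x \<bullet> b = w \<bullet> a)"
proof -
  have R: "(x, w) \<in> R \<longleftrightarrow> (\<forall>(a, b)\<in>R. cinner x b = cinner w a)" for x w
    using assms unfolding positive_selfadjoint_def graph_adjoint_def by blast
  show ?thesis
  proof
    assume "(x, w) \<in> R"
    then show "\<forall>(a, b)\<in>R. x \<bullet> b = w \<bullet> a" by (subst (asm) R) (auto simp flip: Re_cinner)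
  next
    assume *: "\<forall>(a, b)\<in>R. x \<bullet> b = w \<bullet> a"
    have "cinner x b = cinner w a" if "(a, b) \<in> R" for a b
    proof (rule complex_eqI)
      have "(- \<i> *\<^sub>C a, - \<i> *\<^sub>C b) \<in> R"
        unfolding R using that by (subst (asm) R) (auto simp: cinner_scaleC_left)
      then show "Im (cinner x b) = Im (cinner w a)"
        using * by (fastforce simp: Im_cinner inner_scaleC_left)
      show "Re (cinner x b) = Re (cinner w a)" using * that by (auto simp: Re_cinner)
    qed
    then show "(x, w) \<in> R" using R by blast
  qed
qed

section \<open>Closure properties of von Neumann algebras\<close>

context
  fixes M :: "('a::complex_hilbert \<Rightarrow>\<^sub>L 'a) set"
  assumes M: "von_neumann_algebra M"
begin

lemma vn_BH: "x \<in> M \<Longrightarrow> x \<in> BH"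
  using M unfolding von_neumann_algebra_def by blast

lemma vn_adj: "x \<in> M \<Longrightarrow> adj x \<in> M"
  using M unfolding von_neumann_algebra_def by blast

lemma vn_iff: "x \<in> M \<longleftrightarrow> x \<in> BH \<and> (\<forall>y\<in>commutant M. \<forall>\<xi>. y (x \<xi>) = x (y \<xi>))"
proof -
  have "x \<in> M \<longleftrightarrow> x \<in> commutant (commutant M)"
    using M unfolding von_neumann_algebra_def by simp
  then show ?thesis unfolding commutant_def[of "commutant M"] by (simp add: blinfun_eq_iff)
qed

lemma vn_compose: "x \<in> M \<Longrightarrow> y \<in> M \<Longrightarrow> x o\<^sub>L y \<in> M"
  and vn_add: "x \<in> M \<Longrightarrow> y \<in> M \<Longrightarrow> x + y \<in> M"
  and vn_diff: "x \<in> M \<Longrightarrow> y \<in> M \<Longrightarrow> x - y \<in> M"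
  and vn_scale: "x \<in> M \<Longrightarrow> r *\<^sub>R x \<in> M"
  and vn_id: "id_blinfun \<in> M"
  unfolding vn_iff
  by (simp_all add: BH_compose BH_add BH_diff BH_scale BH_id blinfun.bilinear_simps)

text \<open>Complex linearity and commutation with a fixed bounded operator both survive pointwise
  limits.\<close>

lemma vn_strong_limit:
  fixes T :: "'a \<Rightarrow>\<^sub>L 'a" and x :: "nat \<Rightarrow> 'a \<Rightarrow>\<^sub>L 'a"
  assumes x: "\<And>n. x n \<in> M" and lim: "\<And>\<xi>. (\<lambda>n. x n \<xi>) \<longlonglongrightarrow> T \<xi>"
  shows "T \<in> M"
  unfolding vn_iff
proof (intro conjI ballI allI)
  show "T \<in> BH"
    unfolding BH_def
  proof (intro CollectI allI)
    fix c \<xi>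
    have "(\<lambda>n. c *\<^sub>C x n \<xi>) \<longlonglongrightarrow> T (c *\<^sub>C \<xi>)"
      using lim[of "c *\<^sub>C \<xi>"] vn_BH[OF x] unfolding BH_def by simp
    then show "T (c *\<^sub>C \<xi>) = c *\<^sub>C T \<xi>"
      using LIMSEQ_unique tendsto_scaleC[OF lim] by blast
  qed
  fix y \<xi> assume y: "y \<in> commutant M"
  have "(\<lambda>n. y (x n \<xi>)) \<longlonglongrightarrow> y (T \<xi>)" by (intro tendsto_intros lim)
  moreover have "y (x n \<xi>) = x n (y \<xi>)" for n using x[of n] y unfolding vn_iff by blast
  ultimately show "y (T \<xi>) = T (y \<xi>)" using LIMSEQ_unique lim[of "y \<xi>"] by fastforce
qed

end

section \<open>The polar decomposition of the Tomita operator\<close>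

locale graded_modular =
  fixes M :: "('a::complex_hilbert \<Rightarrow>\<^sub>L 'a) set"
    and \<Omega> :: 'a
    and V J :: "'a \<Rightarrow>\<^sub>L 'a"
    and R :: "('a \<times> 'a) set"
  assumes graded: "graded_von_neumann_algebra M \<Omega> V"
    and J: "antiunitary J"
    and R: "positive_selfadjoint R"
    and polar: "tomita_operator M \<Omega> = {(x, J w) | x w. (x, w) \<in> R}"
begin

lemma M: "von_neumann_algebra M"
  and V_BH: "V \<in> BH"
  and V_V [simp]: "V (V \<xi>) = \<xi>"
  and V_\<Omega> [simp]: "V \<Omega> = \<Omega>"
  and V_image: "(\<lambda>x. V o\<^sub>L x o\<^sub>L V) ` M = M"
  and adj_V: "adj V = V"
  and cyclic: "closure {blinfun_apply x \<Omega> | x. x \<in> M} = UNIV"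
  and separating: "x \<in> M \<Longrightarrow> x \<Omega> = 0 \<Longrightarrow> x = 0"
  using graded
  unfolding graded_von_neumann_algebra_def cyclic_vector_def separating_vector_def
  by (auto simp: blinfun_eq_iff)

lemma V_inner: "V x \<bullet> y = x \<bullet> V y"
  using BH_adjoint(2)[OF V_BH] by (simp add: adj_V)

lemmas M_BH = vn_BH[OF M]
  and M_adj = vn_adj[OF M]
  and M_compose = vn_compose[OF M]
  and M_add = vn_add[OF M]
  and M_diff = vn_diff[OF M]
  and M_scale = vn_scale[OF M]
  and M_id = vn_id[OF M]

lemmas M_inner = BH_adjoint(2)[OF M_BH]
  and M_inner_right = BH_adjoint_right[OF M_BH]
  and M_adj_adj = adj_adj[OF M_BH]
  and M_adj_compose = adj_compose[OF M_BH M_BH]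
  and M_adj_add = adj_add[OF M_BH M_BH]
  and M_adj_diff = adj_diff[OF M_BH M_BH]
  and M_adj_scale = adj_scale[OF M_BH]

lemma tomita_core: "x \<in> M \<Longrightarrow> (x \<Omega>, adj x \<Omega>) \<in> tomita_operator M \<Omega>"
  unfolding tomita_operator_def by (rule closure_subset[THEN subsetD]) blast

text \<open>The Tomita operator is a closure, so a continuous map has to be checked on its core
  only.\<close>

lemma tomita_invariant:
  assumes f: "continuous_on UNIV f"
    and core: "\<And>x. x \<in> M \<Longrightarrow> f (x \<Omega>, adj x \<Omega>) \<in> tomita_operator M \<Omega>"
    and z: "z \<in> tomita_operator M \<Omega>"
  shows "f z \<in> tomita_operator M \<Omega>"
proof -
  have "f ` closure {(blinfun_apply x \<Omega>, blinfun_apply (adj x) \<Omega>) | x. x \<in> M} \<subseteq> tomita_operator M \<Omega>"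
    by (rule image_closure_subset)
       (use core continuous_on_subset[OF f] in \<open>auto simp: tomita_operator_def\<close>)
  then show ?thesis using z unfolding tomita_operator_def by blast
qed

lemma tomita_swap: "(x, y) \<in> tomita_operator M \<Omega> \<Longrightarrow> (y, x) \<in> tomita_operator M \<Omega>"
  using tomita_invariant[OF continuous_on_swap, of "(x, y)"] tomita_core[OF M_adj]
  by (simp add: M_adj_adj)

lemma polar_iff: "(x, J w) \<in> tomita_operator M \<Omega> \<longleftrightarrow> (x, w) \<in> R"
proof -
  have "J w = J w' \<Longrightarrow> w = w'" for w w'
    using J unfolding antiunitary_def
    by (metis blinfun.diff_right norm_eq_zero right_minus_eq)
  then show ?thesis unfolding polar by blast
qed

lemma J_surj: "\<exists>w. y = J w"
  using J unfolding antiunitary_def by (metis surjD)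

sublocale positive_selfadjoint_relation R
proof
  show dense: "closure (Domain R) = UNIV" using R unfolding positive_selfadjoint_def by blast
  show sa: "(x, w) \<in> R \<longleftrightarrow> (\<forall>(a, b)\<in>R. x \<bullet> b = w \<bullet> a)" for x w
    using R by (rule positive_selfadjoint_inner_iff)
  show "(x, w) \<in> R \<Longrightarrow> 0 \<le> x \<bullet> w" for x w
    using R unfolding positive_selfadjoint_def
    by (fastforce simp: complex_nonneg_Reals_iff simp flip: Re_cinner)
  \<comment> \<open>If \<open>R\<close> kills \<open>x\<close>, so does the Tomita operator;
    exchanging coordinates, it takes \<open>0\<close> to \<open>x\<close>. Hence
    \<open>x = J w\<close> where \<open>w\<close> is orthogonal to the dense domain of
    \<open>R\<close>.\<close>
  fix x assume "(x, 0) \<in> R"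
  then have "(0, x) \<in> tomita_operator M \<Omega>"
    using polar_iff[of x 0] tomita_swap by (simp add: blinfun.zero_right)
  then obtain w where w: "x = J w" "(0, w) \<in> R" using J_surj polar_iff by metis
  have "w = 0"
    by (rule eq_if_inner_eq_dense[OF dense]) (use w(2) sa in fastforce)
  then show "x = 0" using w(1) by (simp add: blinfun.zero_right)
qed

text \<open>Symmetry of the Tomita operator gives \<open>J R J = R\<^sup>-\<^sup>1\<close>; then \<open>J\<^sup>2 - J\<^sup>-\<^sup>2\<close> anticommutes with
  \<open>R\<close>, and positivity of \<open>R\<close> excludes the eigenvalue \<open>-1\<close> of \<open>J\<^sup>2\<close>.\<close>

lemma J_J [simp]: "J (J \<xi>) = \<xi>"
  and J_inner: "J x \<bullet> y = x \<bullet> J y"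
proof -
  obtain K :: "'a \<Rightarrow>\<^sub>L 'a" where K: "\<And>x y. K x \<bullet> y = x \<bullet> J y"
    using real_adjoint_exists by blast
  have "norm (J x) = norm x" for x using J unfolding antiunitary_def by blast
  then have iso: "J x \<bullet> J y = x \<bullet> y" for x y
    unfolding dot_norm by (simp flip: blinfun.add_right)
  have KJ: "K (J x) = x" for x by (rule eq_if_inner_eq) (simp add: K iso)
  then have JK: "J (K x) = x" for x using J_surj by metis
  have K': "x \<bullet> K y = J x \<bullet> y" for x y using K by (metis inner_commute)
  \<comment> \<open>\<open>K\<close> is the inverse of \<open>J\<close>. \<open>R1\<close> is the
    symmetry of the Tomita operator read through the polar form, and \<open>R2\<close> follows from
    it by self-adjointness of \<open>R\<close>.\<close>
  have R1: "(J w, K x) \<in> R" if "(x, w) \<in> R" for x w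
    using that polar_iff[of x w] tomita_swap polar_iff[of "J w" "K x"] by (simp add: JK)
  have R2: "(K w, J x) \<in> R" if "(x, w) \<in> R" for x w
    by (rule relI) (use symmetric[OF that R1] in \<open>simp add: K K'\<close>)
  have JJ: "J (J \<xi>) = K (K \<xi>)" for \<xi>
  proof -
    let ?d = "(J o\<^sub>L J) - (K o\<^sub>L K)" and ?d' = "(K o\<^sub>L K) - (J o\<^sub>L J)"
    have *: "(K (K x), J (J w)) \<in> R" "(J (J x), K (K w)) \<in> R" if "(x, w) \<in> R" for x w
      using R1[OF R2[OF R2[OF R1[OF that]]]] R2[OF R1[OF R1[OF R2[OF that]]]]
        R2[OF R1[OF that]] R1[OF R2[OF that]] by simp_all
    have "?d = 0"
    proof (rule anticommuting_zero)
      show "?d' x \<bullet> y = x \<bullet> ?d y" for x y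
        by (simp add: blinfun.bilinear_simps inner_simps K K')
    qed (use rel_diff[OF *(1) *(2)] rel_diff[OF *(2) *(1)] in \<open>simp_all add: blinfun.bilinear_simps\<close>)
    then have "?d \<xi> = 0" by simp
    then show ?thesis by (simp add: blinfun.bilinear_simps)
  qed
  have "(J o\<^sub>L J) = id_blinfun"
  proof (rule blinfun_eq_on_dense[OF dense])
    fix x assume "x \<in> Domain R"
    then obtain w where xw: "(x, w) \<in> R" by auto
    \<comment> \<open>As \<open>J\<^sup>2 = K\<^sup>2\<close> has square \<open>1\<close>,
      \<open>v\<close> is mapped to \<open>- v\<close> by it. \<open>R2\<close> turns
      \<open>(v, r)\<close> into \<open>(K r, J v)\<close>, whose form is
      \<open>- (v \<bullet> r)\<close>; both forms are nonnegative, so both vanish.\<close>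
    define v r where "v = x - J (J x)" and "r = w - J (J w)"
    have vr: "(v, r) \<in> R"
      unfolding v_def r_def using rel_diff[OF xw R1[OF R2[OF xw]]] by (simp add: JJ)
    have "J (J v) = - v" unfolding v_def by (simp add: blinfun.bilinear_simps JJ KJ JK)
    then have "K r \<bullet> J v = - (v \<bullet> r)" by (simp add: K[of r "J v"] inner_commute[of v])
    then have "v \<bullet> r = 0" using positive[OF vr] positive[OF R2[OF vr]] by simp
    then have "v = 0" using null_form_imp_zero[OF vr] by blast
    then show "(J o\<^sub>L J) x = id_blinfun x" unfolding v_def by simp
  qed
  then have JJ1: "J (J \<xi>) = \<xi>" for \<xi> by (metis blinfun_apply_blinfun_compose id_blinfun.rep_eq id_apply)
  then show "J (J \<xi>) = \<xi>" .
  show "J x \<bullet> y = x \<bullet> J y" using iso[of x "J y"] JJ1 by simp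
qed

text \<open>\<open>R\<close> exchanges \<open>\<Omega>\<close> and \<open>J \<Omega>\<close>: one
  pair is the polar form at \<open>\<Omega>\<close>, the other follows by self-adjointness from
  \<open>\<Omega> \<bullet> x \<Omega> = \<Omega> \<bullet> adj x \<Omega>\<close>. So
  \<open>R\<close> acts as \<open>-1\<close> on \<open>\<Omega> - J \<Omega>\<close>, which
  positivity allows only for the zero vector.\<close>

lemma J_\<Omega> [simp]: "J \<Omega> = \<Omega>"
proof -
  have "(\<Omega>, \<Omega>) \<in> tomita_operator M \<Omega>" using tomita_core[OF M_id] by (simp add: adj_id)
  then have 1: "(\<Omega>, J \<Omega>) \<in> R" using polar_iff[of \<Omega> "J \<Omega>"] by simp
  have *: "\<Omega> \<bullet> fst z = \<Omega> \<bullet> snd z" if "z \<in> tomita_operator M \<Omega>" for z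
  proof -
    have "closed {z. \<Omega> \<bullet> fst z = \<Omega> \<bullet> snd z}" by (intro closed_Collect_eq continuous_intros)
    then have "closure {(blinfun_apply x \<Omega>, blinfun_apply (adj x) \<Omega>) | x. x \<in> M} \<subseteq> {z. \<Omega> \<bullet> fst z = \<Omega> \<bullet> snd z}"
      by (intro closure_minimal) (auto simp: M_inner_right inner_commute)
    then show ?thesis using that unfolding tomita_operator_def by blast
  qed
  have "(J \<Omega>, \<Omega>) \<in> R"
  proof (rule relI)
    fix a b assume "(a, b) \<in> R"
    then show "J \<Omega> \<bullet> b = \<Omega> \<bullet> a" using *[of "(a, J b)"] polar_iff by (simp add: J_inner)
  qed
  from positive[OF rel_diff[OF 1 this]] have "(\<Omega> - J \<Omega>) \<bullet> (\<Omega> - J \<Omega>) \<le> 0"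
    by (simp add: inner_simps)
  then show ?thesis using inner_ge_zero[of "\<Omega> - J \<Omega>"] by (metis eq_iff_diff_eq_0 inner_eq_zero_iff order_antisym)
qed

text \<open>With \<open>a = J b J\<close> the hypotheses say \<open>R x \<supseteq> a R\<close>, and taking adjoints \<open>R a \<supseteq> x R\<close>; hence
  \<open>x - a\<close> anticommutes with the positive injective operator \<open>R\<close> and vanishes.\<close>

lemma J_conjugate_eq_right_multiplication:
  fixes b b' :: "'a \<Rightarrow>\<^sub>L 'a"
  assumes x: "x \<in> M"
    and adj: "\<And>\<xi> \<eta>. b' \<xi> \<bullet> \<eta> = \<xi> \<bullet> b \<eta>"
    and b: "\<And>y. y \<in> M \<Longrightarrow> b (y \<Omega>) = y (adj x \<Omega>)"
    and b': "\<And>y. y \<in> M \<Longrightarrow> b' (y \<Omega>) = y (x \<Omega>)"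
  shows "J (x (J \<xi>)) = b \<xi>"
proof -
  have adj': "b \<xi> \<bullet> \<eta> = \<xi> \<bullet> b' \<eta>" for \<xi> \<eta> using adj by (metis inner_commute)
  \<comment> \<open>On the core, \<open>x' y \<Omega>\<close> is sent to
    \<open>adj y (adj x' \<Omega>) = c (adj y \<Omega>)\<close>; continuity carries this to the
    closure.\<close>
  have S: "(x' \<xi>, c \<eta>) \<in> tomita_operator M \<Omega>"
    if "(\<xi>, \<eta>) \<in> tomita_operator M \<Omega>" "x' \<in> M" "\<And>y. y \<in> M \<Longrightarrow> c (y \<Omega>) = y (adj x' \<Omega>)"
    for x' \<xi> \<eta> and c :: "'a \<Rightarrow>\<^sub>L 'a"
  proof -
    define f where "f z = (x' (fst z), c (snd z))" for z
    have "f (\<xi>, \<eta>) \<in> tomita_operator M \<Omega>"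
    proof (rule tomita_invariant[of f])
      show "continuous_on UNIV f" unfolding f_def by (intro continuous_intros)
      fix y assume y: "y \<in> M"
      then have "(x' (y \<Omega>), adj (x' o\<^sub>L y) \<Omega>) \<in> tomita_operator M \<Omega>"
        using tomita_core[OF M_compose[OF that(2)]] by simp
      then show "f (y \<Omega>, adj y \<Omega>) \<in> tomita_operator M \<Omega>"
        using y that unfolding f_def by (simp add: M_adj_compose M_adj)
    qed (rule that)
    then show ?thesis unfolding f_def by simp
  qed
  have rx: "(x \<xi>, J (b (J w))) \<in> R" if "(\<xi>, w) \<in> R" for \<xi> w
    using S[of \<xi> "J w" x b] that x b polar_iff[of "x \<xi>" "J (b (J w))"] by (simp add: polar_iff)
  have rx': "(adj x \<xi>, J (b' (J w))) \<in> R" if "(\<xi>, w) \<in> R" for \<xi> w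
    using S[of \<xi> "J w" "adj x" b'] that x b' polar_iff[of "adj x \<xi>" "J (b' (J w))"]
    by (simp add: polar_iff M_adj M_adj_adj)
  have ra: "(J (b (J \<xi>)), x w) \<in> R" if "(\<xi>, w) \<in> R" for \<xi> w
    by (rule relI) (use symmetric[OF that rx'] in \<open>simp add: J_inner adj' M_inner_right x\<close>)
  have ra': "(J (b' (J \<xi>)), adj x w) \<in> R" if "(\<xi>, w) \<in> R" for \<xi> w
    by (rule relI) (use symmetric[OF that rx] in \<open>simp add: J_inner adj M_inner x\<close>)
  have "x - (J o\<^sub>L b o\<^sub>L J) = 0"
  proof (rule anticommuting_zero)
    show "(adj x - (J o\<^sub>L b' o\<^sub>L J)) \<xi> \<bullet> \<eta> = \<xi> \<bullet> (x - (J o\<^sub>L b o\<^sub>L J)) \<eta>" for \<xi> \<eta>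
      by (simp add: blinfun.bilinear_simps inner_simps J_inner adj M_inner x)
  qed (use rel_diff[OF rx ra] rel_diff[OF rx' ra'] in \<open>simp_all add: blinfun.bilinear_simps\<close>)
  then have "x (J \<xi>) = J (b (J (J \<xi>)))" by (simp add: blinfun_eq_iff blinfun.bilinear_simps)
  then show ?thesis by simp
qed

text \<open>Left multiplication by a central element is also right multiplication by it, so the
  preceding lemma applies with \<open>b = adj z\<close> and \<open>b' = z\<close>.\<close>

lemma J_central:
  assumes "z \<in> center M"
  shows "J (z (J \<xi>)) = adj z \<xi>"
proof (rule J_conjugate_eq_right_multiplication)
  show z: "z \<in> M" using assms unfolding center_def by blast
  have comm: "z (y \<eta>) = y (z \<eta>)" if "y \<in> M" for y \<eta>
    using assms that unfolding center_def by (auto simp: blinfun_eq_iff)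
  have comm': "adj z (y \<eta>) = y (adj z \<eta>)" if "y \<in> M" for y \<eta>
    by (rule eq_if_inner_eq)
       (use that comm[OF M_adj] z in \<open>simp add: M_inner flip: M_inner_right\<close>)
  show "z \<eta> \<bullet> \<zeta> = \<eta> \<bullet> adj z \<zeta>" for \<eta> \<zeta> by (simp add: M_inner_right z)
  show "adj z (y \<Omega>) = y (adj z \<Omega>)" "z (y \<Omega>) = y (z \<Omega>)" if "y \<in> M" for y
    using that comm comm' by auto
qed

end

section \<open>The centralizer\<close>

lemma commuting_positive_product:
  fixes e T :: "'a::real_inner \<Rightarrow>\<^sub>L 'a"
  assumes "positive_contraction e" "\<And>x. 0 \<le> x \<bullet> T x" "\<And>x. e (T x) = T (e x)"
  shows "0 \<le> x \<bullet> e (T x)"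
proof -
  have "0 \<le> e x \<bullet> T x"
    by (rule commuting_positive_form[of e "{(x, T x) | x. True}"])
       (use assms in \<open>auto simp flip: blinfun.diff_right\<close>)
  then show ?thesis using assms(1) unfolding positive_contraction_def by simp
qed

lemma blinfun_pointwise_limit:
  fixes T :: "nat \<Rightarrow> 'a::real_normed_vector \<Rightarrow>\<^sub>L 'b::{real_normed_vector,complete_space}"
  assumes bound: "\<And>n x. norm (T n x) \<le> C * norm x" and Cauchy: "\<And>x. Cauchy (\<lambda>n. T n x)"
  obtains S where "\<And>x. (\<lambda>n. T n x) \<longlonglongrightarrow> blinfun_apply S x"
proof -
  define f where "f x = lim (\<lambda>n. T n x)" for x
  have f: "(\<lambda>n. T n x) \<longlonglongrightarrow> f x" for x
    unfolding f_def using Cauchy Cauchy_convergent_iff convergent_LIMSEQ_iff by blast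
  have "bounded_linear f"
  proof (rule bounded_linear_intro)
    fix x y and r :: real
    have "(\<lambda>n. T n (x + y)) \<longlonglongrightarrow> f x + f y"
      unfolding blinfun.add_right by (intro tendsto_intros f)
    then show "f (x + y) = f x + f y" using LIMSEQ_unique f by blast
    have "(\<lambda>n. T n (r *\<^sub>R x)) \<longlonglongrightarrow> r *\<^sub>R f x"
      unfolding blinfun.scaleR_right by (intro tendsto_intros f)
    then show "f (r *\<^sub>R x) = r *\<^sub>R f x" using LIMSEQ_unique f by blast
    have "(\<lambda>n. norm (T n x)) \<longlonglongrightarrow> norm (f x)" by (intro tendsto_intros f)
    then show "norm (f x) \<le> norm x * C"
      by (rule LIMSEQ_le_const2) (use bound in \<open>auto simp: mult.commute\<close>)
  qed
  then show ?thesis using that[of "Blinfun f"] f by (simp add: bounded_linear_Blinfun_apply)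
qed

text \<open>Strong limits of products need a uniform bound on the left factors; here it is
  \<open>1\<close>.\<close>

lemma tendsto_contraction_apply:
  fixes X :: "nat \<Rightarrow> 'a::real_normed_vector \<Rightarrow>\<^sub>L 'b::real_normed_vector" and u :: "'a \<Rightarrow>\<^sub>L 'b"
  assumes contr: "\<And>n x. norm (X n x) \<le> norm x"
    and X: "\<And>x. (\<lambda>n. X n x) \<longlonglongrightarrow> u x" and v: "v \<longlonglongrightarrow> a"
  shows "(\<lambda>n. X n (v n)) \<longlonglongrightarrow> u a"
proof -
  have "(\<lambda>n. norm (v n - a)) \<longlonglongrightarrow> 0" using v by (simp add: tendsto_norm_zero LIM_zero)
  then have "(\<lambda>n. X n (v n - a)) \<longlonglongrightarrow> 0"
    by (rule Lim_null_comparison[rotated]) (use contr in auto)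
  from tendsto_add[OF this X[of a]] show ?thesis by (simp add: blinfun.diff_right)
qed

context graded_modular
begin

text \<open>The two sides are the real parts of the vector state at \<open>x y\<close> and at
  \<open>y x\<close>. Replacing \<open>y\<close> by \<open>\<i> y\<close> recovers the imaginary
  parts, so this is the usual centralizer of the state.\<close>

definition centralizer :: "('a \<Rightarrow>\<^sub>L 'a) set" where
  "centralizer = {x \<in> M. \<forall>y\<in>M.
     adj x \<Omega> \<bullet> blinfun_apply y \<Omega> = adj y \<Omega> \<bullet> blinfun_apply x \<Omega>}"

lemma centralizer_M: "x \<in> centralizer \<Longrightarrow> x \<in> M"
  unfolding centralizer_def by blast

lemma centralizerD: "x \<in> centralizer \<Longrightarrow> y \<in> M \<Longrightarrow> adj x \<Omega> \<bullet> y \<Omega> = adj y \<Omega> \<bullet> x \<Omega>"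
  unfolding centralizer_def by blast

lemma centralizer_adj:
  assumes x: "x \<in> centralizer"
  shows "adj x \<in> centralizer"
  unfolding centralizer_def
proof (intro CollectI conjI ballI)
  note [simp] = centralizer_M[OF x]
  show "adj x \<in> M" by (simp add: M_adj)
  fix y assume y: "y \<in> M"
  show "adj (adj x) \<Omega> \<bullet> y \<Omega> = adj y \<Omega> \<bullet> adj x \<Omega>"
    using centralizerD[OF x M_adj[OF y]] y by (simp add: M_adj_adj inner_commute)
qed

text \<open>Cyclic rotation inside the state: \<open>a b y\<close> becomes \<open>b y a\<close> and
  then \<open>y a b\<close>.\<close>

lemma centralizer_compose:
  assumes a: "a \<in> centralizer" and b: "b \<in> centralizer"
  shows "a o\<^sub>L b \<in> centralizer"
  unfolding centralizer_def
proof (intro CollectI conjI ballI)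
  note [simp] = centralizer_M[OF a] centralizer_M[OF b]
  show "a o\<^sub>L b \<in> M" by (simp add: M_compose)
  fix y assume [simp]: "y \<in> M"
  have "adj (a o\<^sub>L b) \<Omega> \<bullet> y \<Omega> = adj a \<Omega> \<bullet> (b o\<^sub>L y) \<Omega>" by (simp add: M_adj_compose M_inner)
  also have "\<dots> = adj (b o\<^sub>L y) \<Omega> \<bullet> a \<Omega>" by (rule centralizerD[OF a]) (simp add: M_compose)
  also have "\<dots> = adj b \<Omega> \<bullet> (y o\<^sub>L a) \<Omega>" by (simp add: M_adj_compose M_inner)
  also have "\<dots> = adj (y o\<^sub>L a) \<Omega> \<bullet> b \<Omega>" by (rule centralizerD[OF b]) (simp add: M_compose)
  also have "\<dots> = adj y \<Omega> \<bullet> (a o\<^sub>L b) \<Omega>" by (simp add: M_adj_compose M_inner)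
  finally show "adj (a o\<^sub>L b) \<Omega> \<bullet> y \<Omega> = adj y \<Omega> \<bullet> (a o\<^sub>L b) \<Omega>" .
qed

lemma centralizer_diff: "a \<in> centralizer \<Longrightarrow> b \<in> centralizer \<Longrightarrow> a - b \<in> centralizer"
  and centralizer_scale: "a \<in> centralizer \<Longrightarrow> r *\<^sub>R a \<in> centralizer"
  and centralizer_id: "id_blinfun \<in> centralizer"
  unfolding centralizer_def
  by (simp_all add: M_diff M_scale M_id M_adj_diff M_adj_scale adj_id blinfun.bilinear_simps
      inner_simps, simp add: M_inner)

text \<open>The left side is the state at \<open>adj x (adj y) y x\<close>; the trace property moves
  \<open>adj x\<close> to the right end.\<close>

lemma centralizer_norm:
  assumes x: "x \<in> centralizer" and [simp]: "y \<in> M"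
  shows "(norm (y (x \<Omega>)))\<^sup>2 = y \<Omega> \<bullet> y (x (adj x \<Omega>))"
proof -
  note [simp] = centralizer_M[OF x]
  have "adj (adj x) \<Omega> \<bullet> (adj y o\<^sub>L y o\<^sub>L x) \<Omega> = adj (adj y o\<^sub>L y o\<^sub>L x) \<Omega> \<bullet> adj x \<Omega>"
    by (rule centralizerD[OF centralizer_adj[OF x]]) (simp add: M_compose M_adj)
  then have "x \<Omega> \<bullet> adj y (y (x \<Omega>)) = y \<Omega> \<bullet> y (x (adj x \<Omega>))"
    by (simp add: M_adj_adj M_adj_compose M_compose M_adj M_inner)
  then show ?thesis by (simp add: M_inner_right power2_norm_eq_inner)
qed

text \<open>For \<open>e = 1 - c x x\<^sup>*\<close> the remainders \<open>f\<^sub>k\<close> lie in the centralizer, so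
  \<open>\<langle>y \<Omega>, y e \<Omega>\<rangle>\<close> is a sum of the squares \<open>\<parallel>y f\<^sub>k \<Omega>\<parallel>\<^sup>2\<close> up to a null sequence.\<close>

lemma centralizer_right_bounded:
  assumes x: "x \<in> centralizer"
  shows "\<exists>C. \<forall>y\<in>M. norm (y (x \<Omega>)) \<le> C * norm (y \<Omega>)"
proof -
  \<comment> \<open>Chosen so that \<open>c x (adj x)\<close> is at most \<open>1\<close>; its
    inverse reappears as the square of the bound \<open>C\<close>.\<close>
  define c where "c = 1 / ((norm (adj x))\<^sup>2 + 1)"
  define e where "e = id_blinfun - c *\<^sub>R (x o\<^sub>L adj x)"
  note [simp] = centralizer_M[OF x]
  let ?f = "square_remainder e"
  have c: "0 < c" "c * (norm (adj x))\<^sup>2 \<le> 1"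
    unfolding c_def by (auto simp: field_simps add_pos_nonneg intro!: divide_pos_pos)
  have e_pos: "positive_contraction e"
    unfolding positive_contraction_def
  proof (intro conjI allI)
    fix v w
    show "e v \<bullet> w = v \<bullet> e w"
      unfolding e_def by (simp add: blinfun.bilinear_simps inner_simps flip: M_inner[of x] M_inner_right[of x])
    have *: "v \<bullet> e v = (norm v)\<^sup>2 - c * (norm (adj x v))\<^sup>2"
      unfolding e_def
      by (simp add: blinfun.bilinear_simps inner_simps power2_norm_eq_inner flip: M_inner[of x])
    show "v \<bullet> e v \<le> v \<bullet> v" unfolding * using c by (simp add: power2_norm_eq_inner)
    have "(norm (adj x v))\<^sup>2 \<le> (norm (adj x) * norm v)\<^sup>2" by (intro power_mono norm_blinfun) simp
    then have "c * (norm (adj x v))\<^sup>2 \<le> (c * (norm (adj x))\<^sup>2) * (norm v)\<^sup>2"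
      using c(1) by (simp add: power_mult_distrib mult.assoc)
    also have "\<dots> \<le> 1 * (norm v)\<^sup>2" by (intro mult_right_mono c) simp
    finally show "0 \<le> v \<bullet> e v" unfolding * by simp
  qed
  have f_cent: "?f n \<in> centralizer" for n
    by (induction n)
       (auto simp: e_def x intro!: centralizer_diff centralizer_compose centralizer_scale
         centralizer_id centralizer_adj)
  have f_adj: "adj (?f n) = ?f n" for n
    using positive_contraction_square_remainder[OF e_pos] M_BH[OF centralizer_M[OF f_cent]]
    unfolding positive_contraction_def by (intro adj_eqI) auto
  have "norm (y (x \<Omega>)) \<le> sqrt (1 / c) * norm (y \<Omega>)" if y: "y \<in> M" for y
  proof -
    have "y \<Omega> \<bullet> y (?f n \<Omega>) \<le> y \<Omega> \<bullet> y (e \<Omega>)" for n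
    proof -
      have "y \<Omega> \<bullet> y (e \<Omega>) = (\<Sum>k<n. y \<Omega> \<bullet> y (?f k (?f k \<Omega>))) + y \<Omega> \<bullet> y (?f n \<Omega>)"
        by (subst square_remainder_sum[of e \<Omega> n])
           (simp add: inner_simps inner_sum_right blinfun.add_right blinfun.sum_right)
      moreover have "0 \<le> y \<Omega> \<bullet> y (?f k (?f k \<Omega>))" for k
        using centralizer_norm[OF f_cent y, of k] f_adj by (metis zero_le_power2)
      ultimately show ?thesis by (simp add: sum_nonneg)
    qed
    moreover have "(\<lambda>n. y \<Omega> \<bullet> y (?f n \<Omega>)) \<longlonglongrightarrow> y \<Omega> \<bullet> y 0"
      by (intro tendsto_intros square_remainder_tendsto_0 e_pos)
    ultimately have "y \<Omega> \<bullet> y 0 \<le> y \<Omega> \<bullet> y (e \<Omega>)" by (intro LIMSEQ_le_const2) auto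
    then have "c * (norm (y (x \<Omega>)))\<^sup>2 \<le> (norm (y \<Omega>))\<^sup>2"
      unfolding e_def centralizer_norm[OF x y]
      by (simp add: blinfun.bilinear_simps inner_simps power2_norm_eq_inner)
    then have "(norm (y (x \<Omega>)))\<^sup>2 \<le> (sqrt (1 / c) * norm (y \<Omega>))\<^sup>2"
      using c(1) by (simp add: power_mult_distrib field_simps)
    moreover have "0 \<le> sqrt (1 / c) * norm (y \<Omega>)" using c(1) by simp
    ultimately show ?thesis by (rule power2_le_imp_le)
  qed
  then show ?thesis by blast
qed

text \<open>The separating vector makes the map well defined on \<open>M \<Omega>\<close>, the
  preceding bound makes it continuous there, and cyclicity makes its domain dense.\<close>

lemma right_multiplication_exists:
  assumes x: "x \<in> centralizer"
  shows "\<exists>b :: 'a \<Rightarrow>\<^sub>L 'a. \<forall>y\<in>M. b (y \<Omega>) = y (x \<Omega>)"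
proof -
  let ?D = "{blinfun_apply y \<Omega> | y. y \<in> M}"
  obtain C where C: "\<And>y. y \<in> M \<Longrightarrow> norm (y (x \<Omega>)) \<le> C * norm (y \<Omega>)"
    using centralizer_right_bounded[OF x] by blast
  define f where "f \<xi> = (SOME y. y \<in> M \<and> y \<Omega> = \<xi>) (x \<Omega>)" for \<xi>
  have f: "f (y \<Omega>) = y (x \<Omega>)" if y: "y \<in> M" for y
  proof -
    let ?y = "SOME y'. y' \<in> M \<and> y' \<Omega> = y \<Omega>"
    have "?y \<in> M \<and> ?y \<Omega> = y \<Omega>" by (rule someI[where x = y]) (use y in auto)
    then have "?y - y = 0" using separating[OF M_diff[of ?y y]] y by (simp add: blinfun.diff_left)
    then show ?thesis unfolding f_def by simp
  qed
  have "subspace ?D"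
    unfolding subspace_def
  proof (intro conjI ballI allI)
    show "0 \<in> ?D" using M_scale[OF M_id, of 0] by (intro CollectI exI[of _ 0]) simp
    show "v + w \<in> ?D" if "v \<in> ?D" "w \<in> ?D" for v w
      using that by clarsimp (metis M_add blinfun.add_left)
    show "c *\<^sub>R v \<in> ?D" if "v \<in> ?D" for c v
      using that by clarsimp (metis M_scale blinfun.scaleR_left)
  qed
  moreover have "f (v + w) = f v + f w" if "v \<in> ?D" "w \<in> ?D" for v w
    using that by clarsimp (metis f M_add blinfun.add_left)
  moreover have "f (r *\<^sub>R v) = r *\<^sub>R f v" if "v \<in> ?D" for r v
    using that by clarsimp (metis f M_scale blinfun.scaleR_left)
  moreover have "norm (f v) \<le> C * norm v" if "v \<in> ?D" for v
    using that f C by auto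
  ultimately have "\<exists>T :: 'a \<Rightarrow>\<^sub>L 'a. \<forall>v\<in>?D. T v = f v"
    using cyclic by (intro dense_linear_extension[where C = C])
  then obtain T :: "'a \<Rightarrow>\<^sub>L 'a" where "\<And>v. v \<in> ?D \<Longrightarrow> T v = f v" by blast
  then have "T (y \<Omega>) = y (x \<Omega>)" if "y \<in> M" for y
    using that f[OF that] by (metis (mono_tags, lifting) mem_Collect_eq)
  then show ?thesis by blast
qed

text \<open>Right multiplications by \<open>adj x\<close> and by \<open>x\<close> are adjoint to
  each other, by the trace property. This identifies \<open>J x J\<close> with a right
  multiplication, and right multiplications commute with left ones.\<close>

lemma J_centralizer_commutes:
  assumes x: "x \<in> centralizer" and y: "y \<in> M"
  shows "J (x (J (y \<xi>))) = y (J (x (J \<xi>)))"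
proof -
  note [simp] = centralizer_M[OF x]
  obtain b b' :: "'a \<Rightarrow>\<^sub>L 'a" where b: "\<And>y. y \<in> M \<Longrightarrow> b (y \<Omega>) = y (adj x \<Omega>)"
    and b': "\<And>y. y \<in> M \<Longrightarrow> b' (y \<Omega>) = y (x \<Omega>)"
    using right_multiplication_exists[OF x] right_multiplication_exists[OF centralizer_adj[OF x]]
    by blast
  obtain c :: "'a \<Rightarrow>\<^sub>L 'a" where c: "\<And>\<xi> \<eta>. c \<xi> \<bullet> \<eta> = \<xi> \<bullet> b \<eta>" using real_adjoint_exists by blast
  have "c = b'"
  proof (rule blinfun_eq_on_dense[OF cyclic])
    fix \<xi> assume "\<xi> \<in> {blinfun_apply x \<Omega> |x. x \<in> M}"
    then obtain y where y[simp]: "y \<in> M" and \<xi>: "\<xi> = y \<Omega>" by blast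
    show "c \<xi> = b' \<xi>"
    proof (rule eq_if_inner_eq_dense[OF cyclic])
      fix \<eta> assume "\<eta> \<in> {blinfun_apply x \<Omega> |x. x \<in> M}"
      then obtain z where z[simp]: "z \<in> M" and \<eta>: "\<eta> = z \<Omega>" by blast
      have "adj x \<Omega> \<bullet> (adj z o\<^sub>L y) \<Omega> = adj (adj z o\<^sub>L y) \<Omega> \<bullet> x \<Omega>"
        by (rule centralizerD[OF x]) (simp add: M_compose M_adj)
      then have "z (adj x \<Omega>) \<bullet> y \<Omega> = y (x \<Omega>) \<bullet> z \<Omega>"
        by (simp add: M_adj_compose M_adj M_adj_adj M_inner M_inner_right inner_commute[of "x \<Omega>"]
            inner_commute[of "z \<Omega>"])
      then show "c \<xi> \<bullet> \<eta> = b' \<xi> \<bullet> \<eta>"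
        unfolding c \<xi> \<eta> by (simp add: b b' inner_commute[of "y \<Omega>"])
    qed
  qed
  then have "J (x (J \<xi>)) = b \<xi>" for \<xi>
    
    using c b b' J_conjugate_eq_right_multiplication[of x b' b] by simp
  moreover have "b o\<^sub>L y = y o\<^sub>L b"
    by (rule blinfun_eq_on_dense[OF cyclic]) (use b[OF M_compose[OF y]] b y in auto)
  then have "b (y \<xi>) = y (b \<xi>)" by (metis blinfun_apply_blinfun_compose)
  ultimately show ?thesis by simp
qed

section \<open>The twisted center\<close>

lemma center_M: "z \<in> center M \<Longrightarrow> z \<in> M"
  unfolding center_def by blast

lemma center_iff: "z \<in> center M \<longleftrightarrow> z \<in> M \<and> (\<forall>y\<in>M. \<forall>\<xi>. z (y \<xi>) = y (z \<xi>))"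
  unfolding center_def by (simp add: blinfun_eq_iff)

lemma center_commute: "z \<in> center M \<Longrightarrow> y \<in> M \<Longrightarrow> z (y \<xi>) = y (z \<xi>)"
  by (simp add: center_iff)

lemma center_compose:
  assumes z: "z \<in> center M" and w: "w \<in> center M"
  shows "z o\<^sub>L w \<in> center M"
  unfolding center_iff
proof (intro conjI ballI allI)
  show "z o\<^sub>L w \<in> M" using z w by (intro M_compose center_M)
  fix y \<xi> assume y: "y \<in> M"
  show "(z o\<^sub>L w) (y \<xi>) = y ((z o\<^sub>L w) \<xi>)"
    by (simp add: center_commute[OF z y] center_commute[OF w y])
qed

lemma center_add: "z \<in> center M \<Longrightarrow> w \<in> center M \<Longrightarrow> z + w \<in> center M"
  and center_diff: "z \<in> center M \<Longrightarrow> w \<in> center M \<Longrightarrow> z - w \<in> center M"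
  and center_scale: "z \<in> center M \<Longrightarrow> r *\<^sub>R z \<in> center M"
  and center_id: "id_blinfun \<in> center M"
  unfolding center_iff
  by (auto simp: M_add M_diff M_scale M_id blinfun.bilinear_simps)

lemma center_adj:
  assumes z: "z \<in> center M"
  shows "adj z \<in> center M"
  unfolding center_iff
proof (intro conjI ballI allI)
  note [simp] = center_M[OF z]
  show "adj z \<in> M" by (simp add: M_adj)
  fix y \<xi> assume y: "y \<in> M"
  show "adj z (y \<xi>) = y (adj z \<xi>)"
  proof (rule eq_if_inner_eq)
    fix \<eta>
    have "adj z (y \<xi>) \<bullet> \<eta> = \<xi> \<bullet> adj y (z \<eta>)" by (simp add: M_inner M_inner_right y)
    also have "\<dots> = \<xi> \<bullet> z (adj y \<eta>)" by (simp add: center_commute[OF z M_adj[OF y]])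
    also have "\<dots> = y (adj z \<xi>) \<bullet> \<eta>" by (simp add: M_inner_right y flip: M_inner[of z])
    finally show "adj z (y \<xi>) \<bullet> \<eta> = y (adj z \<xi>) \<bullet> \<eta>" .
  qed
qed

lemma Ad_V_M: "y \<in> M \<Longrightarrow> V o\<^sub>L y o\<^sub>L V \<in> M"
  using V_image by blast

abbreviation Z :: "('a \<Rightarrow>\<^sub>L 'a) set" where
  "Z \<equiv> twisted_center J M V"

lemma Z_iff: "x \<in> Z \<longleftrightarrow> x \<in> M \<and> (\<forall>\<xi>. J (adj x (J \<xi>)) = x (V \<xi>))"
  unfolding twisted_center_def by (simp add: blinfun_eq_iff)

lemma Z_M: "x \<in> Z \<Longrightarrow> x \<in> M"
  unfolding Z_iff by blast

lemma Z_J_adj: "x \<in> Z \<Longrightarrow> J (adj x (J \<xi>)) = x (V \<xi>)"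
  unfolding Z_iff by blast

text \<open>The adjoint of the defining relation: \<open>J\<close> and \<open>V\<close> are
  symmetric for the real inner product, so \<open>J (adj x) J = x V\<close> turns into
  \<open>J x J = V (adj x)\<close>.\<close>

lemma Z_J:
  assumes x: "x \<in> Z"
  shows "J (x (J \<xi>)) = V (adj x \<xi>)"
proof (rule eq_if_inner_eq)
  fix \<eta>
  note [simp] = Z_M[OF x]
  have "J (x (J \<xi>)) \<bullet> \<eta> = \<xi> \<bullet> J (adj x (J \<eta>))" by (simp add: J_inner M_inner_right flip: M_inner_right)
  also have "\<dots> = V (adj x \<xi>) \<bullet> \<eta>" by (simp add: Z_J_adj[OF x] V_inner M_inner)
  finally show "J (x (J \<xi>)) \<bullet> \<eta> = V (adj x \<xi>) \<bullet> \<eta>" .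
qed

lemma Z_add: "x \<in> Z \<Longrightarrow> y \<in> Z \<Longrightarrow> x + y \<in> Z"
  and Z_diff: "x \<in> Z \<Longrightarrow> y \<in> Z \<Longrightarrow> x - y \<in> Z"
  and Z_scale: "x \<in> Z \<Longrightarrow> r *\<^sub>R x \<in> Z"
  unfolding Z_iff
  by (simp_all add: M_add M_diff M_scale M_adj_add M_adj_diff M_adj_scale blinfun.bilinear_simps)

lemma Z_compose_central:
  assumes x: "x \<in> Z" and z: "z \<in> center M"
  shows "x o\<^sub>L z \<in> Z"
  unfolding Z_iff
proof (intro conjI allI)
  note [simp] = Z_M[OF x] center_M[OF z]
  show "x o\<^sub>L z \<in> M" by (simp add: M_compose)
  fix \<xi>
  have "J (adj z \<eta>) = z (J \<eta>)" for \<eta>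
    using J_central[OF center_adj[OF z], of "J \<eta>"] by (simp add: M_adj_adj)
  then show "J (adj (x o\<^sub>L z) (J \<xi>)) = (x o\<^sub>L z) (V \<xi>)"
    by (simp add: M_adj_compose Z_J_adj[OF x] center_commute[OF z])
qed

text \<open>Evaluating the defining relation at \<open>\<Omega>\<close> shows that \<open>R\<close>
  fixes \<open>x \<Omega>\<close>. Symmetry of \<open>R\<close> between this vector and
  \<open>adj y \<Omega>\<close>, which \<open>R\<close> sends to \<open>J (y \<Omega>)\<close>, is
  the trace property.\<close>

lemma Z_centralizer:
  assumes x: "x \<in> Z"
  shows "x \<in> centralizer"
  unfolding centralizer_def
proof (intro CollectI conjI ballI)
  show xM: "x \<in> M" using x by (rule Z_M)
  have 1: "J (adj x \<Omega>) = x \<Omega>" using Z_J_adj[OF x, of \<Omega>] by simp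
  then have 2: "J (x \<Omega>) = adj x \<Omega>" by (metis J_J)
  have R_mem: "(y \<Omega>, J (adj y \<Omega>)) \<in> R" if "y \<in> M" for y
    using tomita_core[OF that] polar_iff[of "y \<Omega>" "J (adj y \<Omega>)"] by simp
  fix y assume y: "y \<in> M"
  have "x \<Omega> \<bullet> J (adj (adj y) \<Omega>) = J (adj x \<Omega>) \<bullet> adj y \<Omega>"
    by (rule symmetric[OF R_mem[OF xM] R_mem[OF M_adj[OF y]]])
  then show "adj x \<Omega> \<bullet> y \<Omega> = adj y \<Omega> \<bullet> x \<Omega>"
    by (simp add: 1 2 M_adj_adj y inner_commute flip: J_inner)
qed

lemma Z_intertwines:
  assumes x: "x \<in> Z" and y: "y \<in> M"
  shows "x (V (y \<xi>)) = y (x (V \<xi>))"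
  using J_centralizer_commutes[OF centralizer_adj[OF Z_centralizer[OF x]] y] Z_J_adj[OF x] by simp

lemma Z_intertwines': "x \<in> Z \<Longrightarrow> y \<in> M \<Longrightarrow> y (x \<xi>) = x (V (y (V \<xi>)))"
  using Z_intertwines[of x y "V \<xi>"] by simp

lemma Z_intertwines'': "x \<in> Z \<Longrightarrow> y \<in> M \<Longrightarrow> x (y \<xi>) = V (y (V (x \<xi>)))"
  using Z_intertwines'[of x "V o\<^sub>L y o\<^sub>L V" \<xi>] Ad_V_M by simp

lemma Z_adj_intertwines:
  assumes x: "x \<in> Z" and y: "y \<in> M"
  shows "adj x (y \<xi>) = V (y (V (adj x \<xi>)))"
proof (rule eq_if_inner_eq)
  fix \<eta>
  note [simp] = Z_M[OF x] y
  have "adj x (y \<xi>) \<bullet> \<eta> = \<xi> \<bullet> adj y (x \<eta>)" by (simp add: M_inner M_inner_right)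
  also have "\<dots> = \<xi> \<bullet> x (V (adj y (V \<eta>)))" using Z_intertwines'[OF x M_adj] by simp
  also have "\<dots> = V (y (V (adj x \<xi>))) \<bullet> \<eta>"
    by (simp add: V_inner flip: M_inner_right[of y]) (simp add: M_inner V_inner)
  finally show "adj x (y \<xi>) \<bullet> \<eta> = V (y (V (adj x \<xi>))) \<bullet> \<eta>" .
qed

text \<open>Passing an element of \<open>M\<close> through \<open>y\<close> and then through
  \<open>adj x\<close> conjugates it by \<open>V\<close> twice. Two different elements are allowed
  because \<open>adj u o\<^sub>L x\<close> later serves as the central coefficient of
  \<open>x\<close>.\<close>

lemma Z_abs_central:
  assumes x: "x \<in> Z" and y: "y \<in> Z"
  shows "adj x o\<^sub>L y \<in> center M"
  unfolding center_iff
proof (intro conjI ballI allI)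
  show "adj x o\<^sub>L y \<in> M" using x y by (simp add: M_compose M_adj Z_M)
  fix w \<xi> assume w: "w \<in> M"
  have "(V o\<^sub>L w o\<^sub>L V) \<in> M" using w by (rule Ad_V_M)
  from Z_adj_intertwines[OF x this, of "y \<xi>"]
  show "(adj x o\<^sub>L y) (w \<xi>) = w ((adj x o\<^sub>L y) \<xi>)"
    using Z_intertwines''[OF y w] by simp
qed

text \<open>Conjugation by \<open>J\<close> fixes the self-adjoint central element
  \<open>adj x x\<close>, but it also equals
  \<open>(J (adj x) J) (J x J) = x V V (adj x)\<close>.\<close>

lemma Z_normal:
  assumes x: "x \<in> Z"
  shows "x (adj x \<xi>) = adj x (x \<xi>)"
proof -
  note [simp] = Z_M[OF x]
  have "adj x (x \<xi>) = adj (adj x o\<^sub>L x) \<xi>" by (simp add: M_adj_compose M_adj M_adj_adj)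
  also have "\<dots> = J (adj x (J (J (x (J \<xi>)))))"
    using J_central[OF Z_abs_central[OF x x]] by simp
  also have "\<dots> = x (adj x \<xi>)" by (simp add: Z_J_adj[OF x] Z_J[OF x])
  finally show ?thesis ..
qed

lemma Z_norm_adj:
  assumes x: "x \<in> Z"
  shows "norm (adj x \<xi>) = norm (x \<xi>)"
proof -
  note [simp] = Z_M[OF x]
  have "(norm (adj x \<xi>))\<^sup>2 = (norm (x \<xi>))\<^sup>2"
    by (simp add: power2_norm_eq_inner M_inner Z_normal[OF x] flip: M_inner_right)
  then show ?thesis by simp
qed

text \<open>With \<open>h = adj x x\<close> and \<open>k = V h V\<close>, moving \<open>h\<close>
  through \<open>x\<close> gives \<open>k h = h\<^sup>2\<close>, and conjugation by \<open>V\<close>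
  gives \<open>h k = k\<^sup>2\<close>. Hence \<open>(k - h)\<^sup>2 = 0\<close>, and
  \<open>k - h\<close> is symmetric.\<close>

lemma Z_abs_V_invariant:
  assumes x: "x \<in> Z"
  shows "V (adj x (x (V \<xi>))) = adj x (x \<xi>)"
proof -
  note [simp] = Z_M[OF x]
  define h where "h = adj x o\<^sub>L x"
  have hC: "h \<in> center M" unfolding h_def using x by (intro Z_abs_central)
  have h_sym: "h \<xi> \<bullet> \<eta> = \<xi> \<bullet> h \<eta>" for \<xi> \<eta> unfolding h_def by (simp add: M_inner M_inner_right)
  have hx: "h \<xi> = x (adj x \<xi>)" for \<xi> unfolding h_def by (simp add: Z_normal[OF x])
  have "V (h (V (x \<xi>))) = h (x \<xi>)" for \<xi>
    using Z_intertwines''[OF x center_M[OF hC]] center_commute[OF hC] by simp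
  then have VhVh: "V (h (V (h \<xi>))) = h (h \<xi>)" for \<xi> unfolding hx[of \<xi>] by simp
  then have "V (h (V (h (V \<xi>)))) = h (h (V \<xi>))" for \<xi> by simp
  then have hVhV: "h (V (h (V \<xi>))) = V (h (h (V \<xi>)))" for \<xi> by (metis V_V)
  let ?v = "V (h (V \<xi>))"
  have "?v \<bullet> ?v = \<xi> \<bullet> V (h (h (V \<xi>)))" by (simp add: V_inner h_sym)
  moreover have "h \<xi> \<bullet> ?v = \<xi> \<bullet> V (h (h (V \<xi>)))" by (simp add: h_sym hVhV)
  moreover have "?v \<bullet> h \<xi> = \<xi> \<bullet> h (h \<xi>)" by (simp add: V_inner h_sym VhVh)
  moreover have "h \<xi> \<bullet> h \<xi> = \<xi> \<bullet> h (h \<xi>)" by (simp add: h_sym)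
  ultimately have "(?v - h \<xi>) \<bullet> (?v - h \<xi>) = 0"
    by (simp add: inner_diff_left inner_diff_right inner_commute[of "h \<xi>" ?v])
  then show ?thesis unfolding h_def by simp
qed

text \<open>The last hypothesis makes the squared norms increase and control the increments. Taking
  adjoints is not strongly continuous in general; here differences of the sequence are normal, so
  the adjoints converge as well.\<close>

lemma Z_strong_limit:
  fixes X :: "nat \<Rightarrow> 'a \<Rightarrow>\<^sub>L 'a"
  assumes X: "\<And>n. X n \<in> Z"
    and contr: "\<And>n \<xi>. norm (X n \<xi>) \<le> norm \<xi>"
    and mono: "\<And>m n \<xi>. n \<le> m \<Longrightarrow> (norm (X m \<xi> - X n \<xi>))\<^sup>2 \<le> (norm (X m \<xi>))\<^sup>2 - (norm (X n \<xi>))\<^sup>2"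
  obtains u where "u \<in> Z" "\<And>\<xi>. (\<lambda>n. X n \<xi>) \<longlonglongrightarrow> blinfun_apply u \<xi>"
    "\<And>\<xi>. (\<lambda>n. adj (X n) \<xi>) \<longlonglongrightarrow> blinfun_apply (adj u) \<xi>"
proof -
  note [simp] = Z_M[OF X]
  have Cauchy: "Cauchy (\<lambda>n. X n \<xi>)" for \<xi>
  proof -
    have "incseq (\<lambda>n. (norm (X n \<xi>))\<^sup>2)"
      using order_trans[OF zero_le_power2 mono[OF le_SucI[OF order_refl]]]
      by (intro incseq_SucI) simp
    moreover have "(norm (X n \<xi>))\<^sup>2 \<le> (norm \<xi>)\<^sup>2" for n
      by (intro power_mono contr) simp
    ultimately have "convergent (\<lambda>n. (norm (X n \<xi>))\<^sup>2)"
      using incseq_convergent[of "\<lambda>n. (norm (X n \<xi>))\<^sup>2"] unfolding convergent_def by blast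
    then have C: "Cauchy (\<lambda>n. (norm (X n \<xi>))\<^sup>2)" by (rule convergent_Cauchy)
    show ?thesis
    proof (rule metric_CauchyI)
      fix e :: real assume e: "e > 0"
      then have "0 < e\<^sup>2" by simp
      then obtain N where N: "\<And>m n. m \<ge> N \<Longrightarrow> n \<ge> N \<Longrightarrow>
          dist ((norm (X m \<xi>))\<^sup>2) ((norm (X n \<xi>))\<^sup>2) < e\<^sup>2"
        using metric_CauchyD[OF C] by blast
      have *: "dist (X m \<xi>) (X n \<xi>) < e" if "N \<le> n" "n \<le> m" for m n
      proof -
        have "(dist (X m \<xi>) (X n \<xi>))\<^sup>2 < e\<^sup>2"
          using mono[OF that(2), of \<xi>] N[of m n] that by (simp add: dist_norm)
        then show ?thesis using e by (intro power2_less_imp_less[of _ e]) auto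
      qed
      show "\<exists>N. \<forall>m\<ge>N. \<forall>n\<ge>N. dist (X m \<xi>) (X n \<xi>) < e"
        using * by (intro exI[of _ N] allI impI) (metis dist_commute linear)
    qed
  qed
  obtain u :: "'a \<Rightarrow>\<^sub>L 'a" where u: "\<And>\<xi>. (\<lambda>n. X n \<xi>) \<longlonglongrightarrow> u \<xi>"
    by (rule blinfun_pointwise_limit[of X 1]) (use contr Cauchy in auto)
  have uM: "u \<in> M" using u by (rule vn_strong_limit[OF M, rotated]) simp
  have "Cauchy (\<lambda>n. adj (X n) \<xi>)" for \<xi>
  proof -
    have "dist (adj (X m) \<xi>) (adj (X n) \<xi>) = dist (X m \<xi>) (X n \<xi>)" for m n
      using Z_norm_adj[OF Z_diff[OF X X], of m n \<xi>]
      by (simp add: dist_norm M_adj_diff blinfun.diff_left)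
    then show ?thesis using Cauchy[of \<xi>] unfolding Cauchy_def by simp
  qed
  then obtain s :: "'a \<Rightarrow>\<^sub>L 'a" where s: "\<And>\<xi>. (\<lambda>n. adj (X n) \<xi>) \<longlonglongrightarrow> s \<xi>"
    by (rule blinfun_pointwise_limit[of "\<lambda>n. adj (X n)" 1, rotated])
       (use contr Z_norm_adj[OF X] in auto)
  have "adj u = s"
  proof (rule adj_eqI)
    show "u \<in> BH" using uM by (rule M_BH)
    fix \<xi> \<eta>
    have "(\<lambda>n. adj (X n) \<xi> \<bullet> \<eta>) \<longlonglongrightarrow> s \<xi> \<bullet> \<eta>" by (intro tendsto_intros s)
    moreover have "(\<lambda>n. \<xi> \<bullet> X n \<eta>) \<longlonglongrightarrow> \<xi> \<bullet> u \<eta>" by (intro tendsto_intros u)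
    ultimately show "s \<xi> \<bullet> \<eta> = \<xi> \<bullet> u \<eta>" by (simp add: M_inner LIMSEQ_unique)
  qed
  moreover have "u \<in> Z"
    unfolding Z_iff
  proof (intro conjI allI)
    fix \<xi>
    have "(\<lambda>n. J (adj (X n) (J \<xi>))) \<longlonglongrightarrow> J (adj u (J \<xi>))"
      unfolding \<open>adj u = s\<close> by (intro tendsto_intros s)
    then show "J (adj u (J \<xi>)) = u (V \<xi>)"
      using u[of "V \<xi>"] by (simp add: Z_J_adj[OF X] LIMSEQ_unique)
  qed (rule uM)
  ultimately show ?thesis using that u s by blast
qed

end

section \<open>Partial isometries in the twisted center\<close>

text \<open>On scalars this is \<open>t \<mapsto> t (3 - t\<^sup>2) / 2\<close>, which fixes
  \<open>0\<close> and drives every \<open>t\<close> in \<open>(0, 1]\<close> to \<open>1\<close>.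
  No inverse or square root occurs.\<close>

primrec newton_schulz :: "('a::complex_hilbert \<Rightarrow>\<^sub>L 'a) \<Rightarrow> nat \<Rightarrow> 'a \<Rightarrow>\<^sub>L 'a" where
  "newton_schulz x 0 = x"
| "newton_schulz x (Suc n) = newton_schulz x n o\<^sub>L
     ((3/2) *\<^sub>R id_blinfun - (1/2) *\<^sub>R (adj (newton_schulz x n) o\<^sub>L newton_schulz x n))"

context graded_modular
begin

lemma Z_defect_positive:
  assumes y: "y \<in> Z" and contr: "\<And>\<xi>. norm (y \<xi>) \<le> norm \<xi>"
  shows "positive_contraction (id_blinfun - (adj y o\<^sub>L y))"
  unfolding positive_contraction_def
proof (intro conjI allI)
  note [simp] = Z_M[OF y]
  fix \<xi> \<eta>
  show "(id_blinfun - (adj y o\<^sub>L y)) \<xi> \<bullet> \<eta> = \<xi> \<bullet> (id_blinfun - (adj y o\<^sub>L y)) \<eta>"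
    by (simp add: blinfun.bilinear_simps inner_simps M_inner M_inner_right)
  have *: "\<xi> \<bullet> (id_blinfun - (adj y o\<^sub>L y)) \<xi> = (norm \<xi>)\<^sup>2 - (norm (y \<xi>))\<^sup>2"
    by (simp add: blinfun.bilinear_simps inner_simps M_inner_right power2_norm_eq_inner)
  show "0 \<le> \<xi> \<bullet> (id_blinfun - (adj y o\<^sub>L y)) \<xi>"
    unfolding * using contr[of \<xi>] by (simp add: power_mono)
  show "\<xi> \<bullet> (id_blinfun - (adj y o\<^sub>L y)) \<xi> \<le> \<xi> \<bullet> \<xi>"
    unfolding * by (simp add: power2_norm_eq_inner)
qed

text \<open>The contraction property is preserved because
  \<open>1 - h (3 - h)\<^sup>2 / 4 = (1 - h) (4 - h) (1 - h) / 4\<close>.\<close>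

lemma newton_schulz_Z_contraction:
  assumes x: "x \<in> Z" and contr: "\<And>\<xi>. norm (x \<xi>) \<le> norm \<xi>"
  shows "newton_schulz x n \<in> Z \<and> (\<forall>\<xi>. norm (newton_schulz x n \<xi>) \<le> norm \<xi>)"
proof (induction n)
  case 0
  then show ?case using x contr by simp
next
  case (Suc n)
  define y where "y = newton_schulz x n"
  define h where "h = adj y o\<^sub>L y"
  have y: "y \<in> Z" and yc: "norm (y \<xi>) \<le> norm \<xi>" for \<xi> using Suc unfolding y_def by auto
  note [simp] = Z_M[OF y]
  have h_sym: "h \<xi> \<bullet> \<eta> = \<xi> \<bullet> h \<eta>" for \<xi> \<eta> unfolding h_def by (simp add: M_inner M_inner_right)
  have ns: "newton_schulz x (Suc n) = y o\<^sub>L ((3/2) *\<^sub>R id_blinfun - (1/2) *\<^sub>R h)"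
    unfolding h_def y_def by simp
  have "newton_schulz x (Suc n) \<in> Z"
    unfolding ns h_def
    by (intro Z_compose_central center_diff center_scale center_id Z_abs_central y)
  moreover have "norm (newton_schulz x (Suc n) \<xi>) \<le> norm \<xi>" for \<xi>
  proof -
    define t where "t = \<xi> - h \<xi>"
    have norm_y: "(norm (y \<eta>))\<^sup>2 = \<eta> \<bullet> h \<eta>" for \<eta>
      unfolding h_def by (simp add: M_inner_right power2_norm_eq_inner)
    have "(norm \<xi>)\<^sup>2 - (norm (newton_schulz x (Suc n) \<xi>))\<^sup>2 =
        (norm t)\<^sup>2 - (norm (y t))\<^sup>2 / 4"
      unfolding ns blinfun_apply_blinfun_compose norm_y t_def power2_norm_eq_inner[of \<xi>]
        power2_norm_eq_inner[of "\<xi> - h \<xi>"]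
      by (simp add: blinfun.bilinear_simps inner_simps h_sym inner_commute[of "h \<xi>" \<xi>] field_simps)
    moreover have "(norm (y t))\<^sup>2 \<le> (norm t)\<^sup>2" using yc by (simp add: power_mono)
    ultimately have "(norm (newton_schulz x (Suc n) \<xi>))\<^sup>2 \<le> (norm \<xi>)\<^sup>2"
      using zero_le_power2[of "norm t"] by linarith
    then show ?thesis by simp
  qed
  ultimately show ?case by blast
qed

text \<open>\<open>g\<close> is the product of the factors \<open>1 + t / 2\<close> contributed by
  the steps, \<open>t\<close> being the defect \<open>1 - adj y y\<close> of an iterate. That
  \<open>g\<close> dominates \<open>1\<close> is what makes the iterates increase.\<close>

lemma newton_schulz_factor:
  assumes x: "x \<in> Z" and contr: "\<And>\<xi>. norm (x \<xi>) \<le> norm \<xi>" and nm: "n \<le> m"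
  shows "\<exists>g\<in>center M. (\<forall>\<xi> \<eta>. g \<xi> \<bullet> \<eta> = \<xi> \<bullet> g \<eta>) \<and> (\<forall>\<xi>. 0 \<le> \<xi> \<bullet> (g \<xi> - \<xi>)) \<and>
    (\<forall>\<xi>. newton_schulz x m \<xi> = newton_schulz x n (g \<xi>))"
  using nm
proof (induction m rule: dec_induct)
  case base
  show ?case by (rule bexI[OF _ center_id]) simp
next
  case (step m)
  then obtain g where g: "g \<in> center M" and g_sym: "\<And>\<xi> \<eta>. g \<xi> \<bullet> \<eta> = \<xi> \<bullet> g \<eta>"
    and g_ge: "\<And>\<xi>. 0 \<le> \<xi> \<bullet> (g \<xi> - \<xi>)"
    and g_eq: "\<And>\<xi>. newton_schulz x m \<xi> = newton_schulz x n (g \<xi>)"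
    by blast
  define y where "y = newton_schulz x m"
  have y: "y \<in> Z" and yc: "norm (y \<xi>) \<le> norm \<xi>" for \<xi>
    using newton_schulz_Z_contraction[OF x contr] unfolding y_def by auto
  define t where "t = id_blinfun - (adj y o\<^sub>L y)"
  have t: "t \<in> center M" unfolding t_def by (intro center_diff center_id Z_abs_central y)
  have t_pos: "positive_contraction t" unfolding t_def by (rule Z_defect_positive[OF y yc])
  then have t_sym: "t \<xi> \<bullet> \<eta> = \<xi> \<bullet> t \<eta>" and t_ge: "0 \<le> \<xi> \<bullet> t \<xi>" for \<xi> \<eta>
    unfolding positive_contraction_def by auto
  have tg: "t (g \<xi>) = g (t \<xi>)" for \<xi> using center_commute[OF t center_M[OF g]] .
  let ?g = "g o\<^sub>L (id_blinfun + (1/2) *\<^sub>R t)"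
  have "?g \<in> center M" by (intro center_compose center_add center_scale center_id g t)
  moreover have "?g \<xi> \<bullet> \<eta> = \<xi> \<bullet> ?g \<eta>" for \<xi> \<eta>
    by (simp add: blinfun.bilinear_simps inner_simps g_sym t_sym tg)
  moreover have "0 \<le> \<xi> \<bullet> (?g \<xi> - \<xi>)" for \<xi>
  proof -
    \<comment> \<open>In \<open>g (1 + t / 2) - 1 = (g - 1) + t / 2 + t (g - 1) / 2\<close> only the
      last term needs an argument: it is a product of commuting positive operators.\<close>
    have "0 \<le> \<xi> \<bullet> t ((g - id_blinfun) \<xi>)"
      by (rule commuting_positive_product[OF t_pos])
         (use g_ge in \<open>simp_all add: blinfun.bilinear_simps tg\<close>)
    then show ?thesis
      using g_ge[of \<xi>] t_ge[of \<xi>] by (simp add: blinfun.bilinear_simps inner_simps tg)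
  qed
  moreover have "newton_schulz x (Suc m) \<xi> = newton_schulz x n (?g \<xi>)" for \<xi>
  proof -
    have "newton_schulz x (Suc m) \<xi> = y (\<xi> + (1/2) *\<^sub>R t \<xi>)"
      using scaleR_left_distrib[of 1 "1/2" "y \<xi>"] unfolding t_def y_def
      by (simp add: blinfun.bilinear_simps algebra_simps)
    then show ?thesis unfolding y_def g_eq by (simp add: blinfun.bilinear_simps)
  qed
  ultimately show ?case by blast
qed

definition pisom :: "('a \<Rightarrow>\<^sub>L 'a) \<Rightarrow> bool" where
  "pisom u \<longleftrightarrow> u \<in> Z \<and> (\<forall>\<xi>. u (adj u (u \<xi>)) = u \<xi>)"

text \<open>The limit of the Newton--Schulz iteration \<open>x \<mapsto> x (3 - x\<^sup>* x) / 2\<close> is the partial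
  isometry in the polar decomposition of \<open>x\<close>; the iterates stay in the twisted center because
  \<open>x\<^sup>* x\<close> is central.\<close>

lemma pisom_of_contraction:
  assumes x: "x \<in> Z" and contr: "\<And>\<xi>. norm (x \<xi>) \<le> norm \<xi>"
  obtains u where "pisom u" "\<And>\<xi>. norm (x \<xi>) \<le> norm (blinfun_apply u \<xi>)"
    "\<And>p \<xi>. p \<in> M \<Longrightarrow> (\<And>\<xi>. blinfun_apply p (x \<xi>) = x \<xi>) \<Longrightarrow> p (u \<xi>) = u \<xi>"
proof -
  let ?X = "newton_schulz x"
  have XZ: "?X n \<in> Z" and Xc: "norm (?X n \<xi>) \<le> norm \<xi>" for n \<xi>
    using newton_schulz_Z_contraction[OF x contr] by auto
  note [simp] = Z_M[OF XZ]
  have mono: "(norm (?X m \<xi> - ?X n \<xi>))\<^sup>2 \<le> (norm (?X m \<xi>))\<^sup>2 - (norm (?X n \<xi>))\<^sup>2"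
    if "n \<le> m" for m n \<xi>
  proof -
    obtain g where g: "g \<in> center M" and g_ge: "\<And>\<xi>. 0 \<le> \<xi> \<bullet> (g \<xi> - \<xi>)"
      and g_eq: "\<And>\<xi>. ?X m \<xi> = ?X n (g \<xi>)"
      using newton_schulz_factor[OF x contr \<open>n \<le> m\<close>] by blast
    \<comment> \<open>With the central factor in front,
      \<open>?X n \<xi> \<bullet> ?X m \<xi>\<close> is at least the squared norm of
      \<open>?X n \<xi>\<close>; expanding the square gives the claim.\<close>
    have "?X m \<xi> = g (?X n \<xi>)" using center_commute[OF g, of "?X n"] g_eq by simp
    then have "0 \<le> ?X n \<xi> \<bullet> ?X m \<xi> - ?X n \<xi> \<bullet> ?X n \<xi>"
      using g_ge[of "?X n \<xi>"] by (simp add: inner_simps)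
    then show ?thesis
      by (simp add: power2_norm_eq_inner inner_simps inner_commute[of "?X m \<xi>" "?X n \<xi>"])
  qed
  obtain u where u: "u \<in> Z" and lim: "\<And>\<xi>. (\<lambda>n. ?X n \<xi>) \<longlonglongrightarrow> u \<xi>"
    and lim': "\<And>\<xi>. (\<lambda>n. adj (?X n) \<xi>) \<longlonglongrightarrow> adj u \<xi>"
    using Z_strong_limit[of ?X, OF XZ Xc mono] by blast
  have "u (adj u (u \<xi>)) = u \<xi>" for \<xi>
  proof -
    have Xc': "norm (adj (?X n) \<xi>) \<le> norm \<xi>" for n \<xi> using Z_norm_adj[OF XZ] Xc by simp
    \<comment> \<open>Both sides of the recursion have limits, so the limit satisfies
      \<open>u = (3/2) u - (1/2) u (adj u) u\<close>.\<close>
    have "(\<lambda>n. (3/2) *\<^sub>R ?X n \<xi> - (1/2) *\<^sub>R ?X n (adj (?X n) (?X n \<xi>))) \<longlonglongrightarrow>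
        (3/2) *\<^sub>R u \<xi> - (1/2) *\<^sub>R u (adj u (u \<xi>))"
      by (intro tendsto_intros lim tendsto_contraction_apply[OF Xc lim]
          tendsto_contraction_apply[OF Xc' lim'])
    moreover have "(\<lambda>n. ?X (Suc n) \<xi>) \<longlonglongrightarrow> u \<xi>" by (rule LIMSEQ_Suc[OF lim])
    ultimately have "(3/2) *\<^sub>R u \<xi> - (1/2) *\<^sub>R u (adj u (u \<xi>)) = u \<xi>"
      by (intro LIMSEQ_unique) (simp_all add: blinfun.bilinear_simps)
    then have "(1/2) *\<^sub>R u (adj u (u \<xi>)) = (3/2) *\<^sub>R u \<xi> - 1 *\<^sub>R u \<xi>"
      by (metis add.commute add_diff_cancel_left' diff_add_cancel scaleR_one)
    also have "\<dots> = (1/2) *\<^sub>R u \<xi>" unfolding scaleR_left_diff_distrib[symmetric] by simp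
    finally show ?thesis by simp
  qed
  with u have "pisom u" unfolding pisom_def by blast
  moreover have "norm (x \<xi>) \<le> norm (u \<xi>)" for \<xi>
  proof (rule LIMSEQ_le_const[OF tendsto_norm[OF lim]], intro exI allI impI)
    fix n
    have "(norm (x \<xi>))\<^sup>2 \<le> (norm (?X n \<xi>))\<^sup>2"
      using order_trans[OF zero_le_power2 mono[of 0 n \<xi>]] by simp
    then show "norm (x \<xi>) \<le> norm (?X n \<xi>)" by simp
  qed
  moreover have "p (u \<xi>) = u \<xi>" if p: "p \<in> M" and px: "\<And>\<xi>. p (x \<xi>) = x \<xi>" for p \<xi>
  proof -
    have "p (?X n \<xi>) = ?X n \<xi>" for n \<xi>
      by (induction n arbitrary: \<xi>) (simp_all add: px)
    moreover have "(\<lambda>n. p (?X n \<xi>)) \<longlonglongrightarrow> p (u \<xi>)" by (intro tendsto_intros lim)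
    ultimately show ?thesis using lim[of \<xi>] by (simp add: LIMSEQ_unique)
  qed
  ultimately show ?thesis using that by blast
qed

lemma pisom_Z: "pisom u \<Longrightarrow> u \<in> Z"
  and pisom_abs: "pisom u \<Longrightarrow> u (adj u (u \<xi>)) = u \<xi>"
  unfolding pisom_def by auto

section \<open>Supports, central projections and corners\<close>

definition support :: "('a \<Rightarrow>\<^sub>L 'a) \<Rightarrow> 'a \<Rightarrow>\<^sub>L 'a" where
  "support u = adj u o\<^sub>L u"

definition central_projection :: "('a \<Rightarrow>\<^sub>L 'a) \<Rightarrow> bool" where
  "central_projection p \<longleftrightarrow> is_projection p \<and> p \<in> invariant_center M V"

lemma central_projection_iff:
  "central_projection p \<longleftrightarrow>
     p \<in> center M \<and> adj p = p \<and> (\<forall>\<xi>. p (p \<xi>) = p \<xi>) \<and> (\<forall>\<xi>. V (p (V \<xi>)) = p \<xi>)"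
  unfolding central_projection_def is_projection_def invariant_center_def
  using M_BH[OF center_M] by (auto simp: blinfun_eq_iff)

context
  fixes p assumes p: "central_projection p"
begin

lemma cp_center: "p \<in> center M"
  using p unfolding central_projection_iff by blast

lemma cp_M: "p \<in> M"
  using cp_center by (rule center_M)

lemma cp_adj: "adj p = p"
  using p unfolding central_projection_iff by blast

lemma cp_idem: "p (p \<xi>) = p \<xi>"
  using p unfolding central_projection_iff by blast

lemma cp_sym: "p \<xi> \<bullet> \<eta> = \<xi> \<bullet> p \<eta>"
  using M_inner[OF cp_M] by (simp add: cp_adj)

lemma cp_V: "V (p \<xi>) = p (V \<xi>)"
proof -
  have "V (p (V (V \<xi>))) = p (V \<xi>)" using p unfolding central_projection_iff by blast
  then show ?thesis by simp
qed

lemma cp_J: "J (p \<xi>) = p (J \<xi>)"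
  using J_central[OF cp_center, of "J \<xi>"] by (simp add: cp_adj)

lemma cp_commute: "y \<in> M \<Longrightarrow> y (p \<xi>) = p (y \<xi>)"
  using center_commute[OF cp_center] by simp

lemma corner_image_iff: "x \<in> corner p ` M \<longleftrightarrow> x \<in> M \<and> (\<forall>\<xi>. p (x \<xi>) = x \<xi>)"
proof
  assume "x \<in> corner p ` M"
  then show "x \<in> M \<and> (\<forall>\<xi>. p (x \<xi>) = x \<xi>)"
    unfolding corner_def using cp_M by (auto simp: cp_idem intro!: M_compose)
next
  assume x: "x \<in> M \<and> (\<forall>\<xi>. p (x \<xi>) = x \<xi>)"
  then have "x = corner p x" unfolding corner_def by (simp add: blinfun_eq_iff cp_commute)
  then show "x \<in> corner p ` M" using x by blast
qed

text \<open>\<open>p\<close> commutes with \<open>J\<close> and \<open>V\<close>, and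
  \<open>x = p x p\<close>, so cutting \<open>J\<close> and \<open>V\<close> down to the corner does
  not change the defining relation.\<close>

lemma corner_twisted_center_iff:
  "x \<in> corner_twisted_center J M V p \<longleftrightarrow> x \<in> Z \<and> (\<forall>\<xi>. p (x \<xi>) = x \<xi>)"
proof (cases "x \<in> M \<and> (\<forall>\<xi>. p (x \<xi>) = x \<xi>)")
  case True
  then have xM: "x \<in> M" and px: "p (x \<xi>) = x \<xi>" for \<xi> by auto
  have xp: "x (p \<xi>) = x \<xi>" for \<xi> using cp_commute[OF xM] px by simp
  have "adj x (p \<xi>) = adj x \<xi>" for \<xi>
    by (rule eq_if_inner_eq) (simp add: M_inner xM cp_sym px)
  then have ax: "p (adj x \<xi>) = adj x \<xi>" "adj x (p \<xi>) = adj x \<xi>" for \<xi>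
    using cp_commute[OF M_adj[OF xM]] by simp_all
  have pJ: "p (J (adj x \<xi>)) = J (adj x \<xi>)" for \<xi> by (metis ax(1) cp_J)
  have "corner p J o\<^sub>L adj x o\<^sub>L corner p J = x o\<^sub>L corner p V \<longleftrightarrow>
      J o\<^sub>L adj x o\<^sub>L J = x o\<^sub>L V"
    unfolding corner_def blinfun_eq_iff by (simp add: ax xp cp_V cp_J pJ cp_idem)
  then show ?thesis
    using True unfolding corner_twisted_center_def twisted_center_def corner_image_iff by blast
next
  case False
  then show ?thesis
    unfolding corner_twisted_center_def twisted_center_def[of "corner p J"] corner_image_iff
    using Z_M by blast
qed

text \<open>An element living on \<open>p\<close> sees \<open>y\<close> only through
  \<open>p y\<close>, so commuting with the corner already means commuting with
  \<open>M\<close>.\<close>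

lemma center_corner_iff: "z \<in> center (corner p ` M) \<longleftrightarrow> z \<in> center M \<and> (\<forall>\<xi>. p (z \<xi>) = z \<xi>)"
proof
  assume *: "z \<in> center (corner p ` M)"
  then have z: "z \<in> M" and pz: "p (z \<xi>) = z \<xi>" for \<xi>
    using corner_image_iff unfolding center_def by blast+
  have "z (y \<xi>) = y (z \<xi>)" if y: "y \<in> M" for y \<xi>
  proof -
    have "p o\<^sub>L y \<in> corner p ` M"
      unfolding corner_image_iff using y by (simp add: M_compose cp_M cp_idem)
    then have "z o\<^sub>L (p o\<^sub>L y) = (p o\<^sub>L y) o\<^sub>L z" using * unfolding center_def by blast
    then have "z (p (y \<xi>)) = p (y (z \<xi>))" by (simp add: blinfun_eq_iff)
    then show ?thesis using cp_commute[OF z] cp_commute[OF y] pz by metis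
  qed
  then show "z \<in> center M \<and> (\<forall>\<xi>. p (z \<xi>) = z \<xi>)" using z pz unfolding center_iff by blast
next
  assume *: "z \<in> center M \<and> (\<forall>\<xi>. p (z \<xi>) = z \<xi>)"
  then have "z \<in> corner p ` M" unfolding corner_image_iff using center_M by blast
  then show "z \<in> center (corner p ` M)"
    using * corner_image_iff unfolding center_def by blast
qed

lemma central_projection_compl: "central_projection (id_blinfun - p)"
  unfolding central_projection_iff
  using center_diff[OF center_id cp_center]
  by (simp add: adj_diff BH_id adj_id M_BH[OF cp_M] cp_adj blinfun.bilinear_simps cp_idem cp_V)

end

lemma central_projection_support:
  assumes u: "pisom u"
  shows "central_projection (support u)"
proof -
  note [simp] = Z_M[OF pisom_Z[OF u]]
  show ?thesis
    unfolding central_projection_iff support_def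
    using Z_abs_central[OF pisom_Z[OF u] pisom_Z[OF u]] Z_abs_V_invariant[OF pisom_Z[OF u]]
    by (simp add: M_adj_compose M_adj M_adj_adj pisom_abs[OF u])
qed

lemma support_right: "pisom u \<Longrightarrow> u (support u \<xi>) = u \<xi>"
  unfolding support_def by (simp add: pisom_abs)

lemma support_left: "pisom u \<Longrightarrow> support u (u \<xi>) = u \<xi>"
  using support_right cp_commute[OF central_projection_support Z_M[OF pisom_Z]] by metis

lemma support_inner: "pisom u \<Longrightarrow> \<xi> \<bullet> support u \<xi> = (norm (u \<xi>))\<^sup>2"
  unfolding support_def by (simp add: M_inner_right Z_M pisom_Z power2_norm_eq_inner)

lemma twisted_unitary_support:
  assumes u: "pisom u"
  shows "twisted_unitary J M V (support u) u"
  unfolding twisted_unitary_def partial_isometry_def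
    corner_twisted_center_iff[OF central_projection_support[OF u]]
  using u M_BH[OF Z_M[OF pisom_Z[OF u]]]
  by (simp add: blinfun_eq_iff support_left pisom_Z pisom_abs)
     (simp add: support_def Z_normal pisom_Z)

lemma twisted_unitaryD:
  assumes p: "central_projection p" and u: "twisted_unitary J M V p u"
  shows "pisom u" "support u = p"
  using u unfolding twisted_unitary_def partial_isometry_def corner_twisted_center_iff[OF p]
    pisom_def support_def by (auto simp: blinfun_eq_iff)

text \<open>From here on, statements about admissible projections are statements about partial
  isometries in \<open>Z\<close>.\<close>

lemma admissible_iff: "admissible J M V p \<longleftrightarrow> (\<exists>u. pisom u \<and> p = support u)"
proof
  assume "admissible J M V p"
  then show "\<exists>u. pisom u \<and> p = support u"
    using twisted_unitaryD unfolding admissible_def central_projection_def by blast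
next
  assume "\<exists>u. pisom u \<and> p = support u"
  then show "admissible J M V p"
    using twisted_unitary_support central_projection_support
    unfolding admissible_def central_projection_def by blast
qed

section \<open>Order and gluing of partial isometries\<close>

lemma pisom_norm_le:
  assumes u: "pisom u"
  shows "norm (u \<xi>) \<le> norm \<xi>"
proof -
  let ?p = "support u"
  note cp = central_projection_support[OF u]
  have "(norm (?p \<xi>))\<^sup>2 = (norm (u \<xi>))\<^sup>2"
    by (simp add: power2_norm_eq_inner[of "?p \<xi>"] cp_sym[OF cp] cp_idem[OF cp] support_inner[OF u])
  then have eq: "norm (?p \<xi>) = norm (u \<xi>)" by simp
  have "norm (u \<xi>) * norm (u \<xi>) \<le> norm \<xi> * norm (u \<xi>)"
    using norm_cauchy_schwarz[of \<xi> "?p \<xi>"] support_inner[OF u, of \<xi>]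
    by (simp add: eq power2_eq_square)
  then show ?thesis by (cases "u \<xi> = 0") auto
qed

definition extends :: "('a \<Rightarrow>\<^sub>L 'a) \<Rightarrow> ('a \<Rightarrow>\<^sub>L 'a) \<Rightarrow> bool" where
  "extends v u \<longleftrightarrow> (\<forall>\<xi>. v (support u \<xi>) = u \<xi>)"

lemma extends_refl: "pisom u \<Longrightarrow> extends u u"
  unfolding extends_def by (simp add: support_right)

lemma extends_support:
  assumes u: "pisom u" and v: "pisom v" and ext: "extends v u"
  shows "support v (support u \<xi>) = support u \<xi>"
proof -
  note p = central_projection_support[OF u] and vM = Z_M[OF pisom_Z[OF v]]
  have vp: "v (support u \<xi>) = u \<xi>" for \<xi> using ext unfolding extends_def by blast
  have 1: "support v (support u \<xi>) = adj v (u \<xi>)" for \<xi>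
    unfolding support_def[of v] by (simp add: vp)
  have "support u \<xi> = adj v (u \<xi>)"
  proof (rule eq_if_inner_eq)
    fix \<eta>
    have "adj v (u \<xi>) \<bullet> \<eta> = support u (u \<xi>) \<bullet> v \<eta>" by (simp add: support_left u M_inner vM)
    also have "\<dots> = u \<xi> \<bullet> u \<eta>" by (simp add: cp_sym[OF p] vp flip: cp_commute[OF p vM])
    also have "\<dots> = support u \<xi> \<bullet> \<eta>"
      unfolding support_def by (simp add: M_inner[OF M_adj] Z_M[OF pisom_Z[OF u]] M_inner)
    finally show "support u \<xi> \<bullet> \<eta> = adj v (u \<xi>) \<bullet> \<eta>" ..
  qed
  then show ?thesis using 1 by metis
qed

lemma extends_trans:
  assumes "pisom u" "pisom v" "extends v u" "extends w v"
  shows "extends w u"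
  using assms extends_support[OF assms(1-3)] unfolding extends_def by metis

text \<open>Pythagoras: \<open>v - u\<close> lives off the support of \<open>u\<close>. Along a
  chain of extensions this is the increment condition of \<open>Z_strong_limit\<close>.\<close>

lemma extends_norm:
  assumes u: "pisom u" and v: "pisom v" and ext: "extends v u"
  shows "(norm (v \<xi> - u \<xi>))\<^sup>2 = (norm (v \<xi>))\<^sup>2 - (norm (u \<xi>))\<^sup>2"
proof -
  have "v \<xi> \<bullet> u \<xi> = v \<xi> \<bullet> v (support u \<xi>)" using ext unfolding extends_def by simp
  also have "\<dots> = \<xi> \<bullet> support v (support u \<xi>)"
    unfolding support_def[of v] by (simp add: M_inner_right Z_M pisom_Z v)
  also have "\<dots> = (norm (u \<xi>))\<^sup>2" by (simp add: extends_support[OF assms] support_inner u)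
  finally show ?thesis
    by (simp add: power2_norm_eq_inner inner_simps inner_commute[of "u \<xi>" "v \<xi>"])
qed

text \<open>\<open>u\<close> and \<open>v\<close> may disagree where their supports overlap, so
  \<open>u\<close> takes precedence there and \<open>v\<close> is cut down to the
  complement.\<close>

definition pisom_join :: "('a \<Rightarrow>\<^sub>L 'a) \<Rightarrow> ('a \<Rightarrow>\<^sub>L 'a) \<Rightarrow> 'a \<Rightarrow>\<^sub>L 'a" where
  "pisom_join u v = u + (v o\<^sub>L (id_blinfun - support u))"

text \<open>The mixed terms vanish because \<open>u\<close> lives on the central projection
  \<open>p\<close> and the rest on \<open>1 - p\<close>. The new support is
  \<open>p + q - p q\<close>, which dominates both \<open>p\<close> and \<open>q\<close>.\<close>

lemma pisom_join:
  assumes u: "pisom u" and v: "pisom v"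
  shows pisom_join_pisom: "pisom (pisom_join u v)"
    and extends_join: "extends (pisom_join u v) u"
    and norm_join: "(norm (pisom_join u v \<xi>))\<^sup>2 = (norm (u \<xi>))\<^sup>2 + (norm (v (\<xi> - support u \<xi>)))\<^sup>2"
    and norm_join_ge: "norm (v \<xi>) \<le> norm (pisom_join u v \<xi>)"
proof -
  define p where "p = support u"
  define q where "q = support v"
  note p = central_projection_support[OF u, folded p_def]
    and q = central_projection_support[OF v, folded q_def]
  note [simp] = Z_M[OF pisom_Z[OF u]] Z_M[OF pisom_Z[OF v]]
  let ?w = "pisom_join u v"
  have w: "?w \<xi> = u \<xi> + v (\<xi> - p \<xi>)" for \<xi>
    unfolding pisom_join_def p_def by (simp add: blinfun.bilinear_simps)
  have w': "adj ?w \<xi> = adj u \<xi> + (adj v \<xi> - p (adj v \<xi>))" for \<xi>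
    unfolding pisom_join_def
    by (simp add: p_def[symmetric] M_adj_add M_compose M_diff M_id cp_M[OF p] M_adj_compose
        M_adj_diff adj_id cp_adj[OF p] blinfun.bilinear_simps)
  have up: "u (p \<xi>) = u \<xi>" and pu: "p (u \<xi>) = u \<xi>" and vq: "v (q \<xi>) = v \<xi>" for \<xi>
    unfolding p_def q_def by (simp_all add: support_right support_left u v)
  have vp: "v (p \<xi>) = p (v \<xi>)" and a_up: "adj u (p \<xi>) = p (adj u \<xi>)"
    and a_vp: "adj v (p \<xi>) = p (adj v \<xi>)" and pq: "q (p \<xi>) = p (q \<xi>)" for \<xi>
    using cp_commute[OF p] by (simp_all add: M_adj cp_M[OF q])
  have wu: "p (adj u \<xi>) = adj u \<xi>" for \<xi>
    by (rule eq_if_inner_eq) (simp add: cp_sym[OF p] M_inner up)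
  have uu: "adj u (u \<xi>) = p \<xi>" and vv: "adj v (v \<xi>) = q \<xi>" for \<xi>
    unfolding p_def q_def support_def by simp_all
  have uv: "adj u (v \<xi> - p (v \<xi>)) = 0" for \<xi> by (simp add: blinfun.diff_right a_up wu)
  have vu: "adj v (u \<xi>) - p (adj v (u \<xi>)) = 0" for \<xi> by (simp add: pu flip: a_vp)
  have abs: "adj ?w (?w \<xi>) = p \<xi> + (q \<xi> - p (q \<xi>))" for \<xi>
  proof -
    have "adj ?w (?w \<xi>) = adj u (u \<xi>) + adj u (v \<xi> - p (v \<xi>))
        + (adj v (u \<xi>) - p (adj v (u \<xi>))) + (adj v (v (\<xi> - p \<xi>)) - p (adj v (v (\<xi> - p \<xi>))))"
      unfolding w w' by (simp add: blinfun.bilinear_simps vp algebra_simps)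
    also have "\<dots> = p \<xi> + (q \<xi> - p (q \<xi>))"
      unfolding uv vu uu vv by (simp add: blinfun.bilinear_simps pq cp_idem[OF p])
    finally show ?thesis .
  qed
  have "?w \<in> Z"
    unfolding pisom_join_def
    by (intro Z_add Z_compose_central pisom_Z u v center_diff center_id
        cp_center[OF central_projection_support[OF u]])
  moreover have "?w (adj ?w (?w \<xi>)) = ?w \<xi>" for \<xi>
  proof -
    have "?w (p \<xi> + (q \<xi> - p (q \<xi>))) = ?w \<xi>"
      unfolding w by (simp add: blinfun.bilinear_simps up vp vq cp_idem[OF p])
    then show ?thesis unfolding abs .
  qed
  ultimately show pw: "pisom ?w" unfolding pisom_def by blast
  show "extends ?w u"
    unfolding extends_def p_def[symmetric] w by (simp add: cp_idem[OF p] up blinfun.zero_right)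
  show "(norm (?w \<xi>))\<^sup>2 = (norm (u \<xi>))\<^sup>2 + (norm (v (\<xi> - support u \<xi>)))\<^sup>2"
    using extends_norm[OF u pw \<open>extends ?w u\<close>, of \<xi>] unfolding w p_def by simp
  have "(norm (?w \<xi>))\<^sup>2 = \<xi> \<bullet> (p \<xi> + (q \<xi> - p (q \<xi>)))"
    using support_inner[OF pw, of \<xi>] abs unfolding support_def by simp
  also have "\<dots> = (norm (v \<xi>))\<^sup>2 + ((norm (p \<xi>))\<^sup>2 - (norm (v (p \<xi>)))\<^sup>2)"
    using support_inner[OF v, of \<xi>] support_inner[OF v, of "p \<xi>"]
    by (simp add: q_def[symmetric] inner_simps power2_norm_eq_inner[of "p \<xi>"] cp_sym[OF p] cp_idem[OF p] pq)
  also have "\<dots> \<ge> (norm (v \<xi>))\<^sup>2" using pisom_norm_le[OF v, of "p \<xi>"] by (simp add: power_mono)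
  finally show "norm (v \<xi>) \<le> norm (?w \<xi>)" by simp
qed

end

section \<open>The greatest support\<close>

lemma projection_le_iff:
  assumes "is_projection q"
  shows "projection_le p q \<longleftrightarrow> q o\<^sub>L p = p"
proof -
  have q: "q (q \<xi>) = q \<xi>" for \<xi> using assms unfolding is_projection_def by (simp add: blinfun_eq_iff)
  have "range p \<subseteq> range q \<longleftrightarrow> (\<forall>\<xi>. q (p \<xi>) = p \<xi>)"
    using q by (auto simp: image_iff subset_iff) metis+
  then show ?thesis unfolding projection_le_def by (simp add: blinfun_eq_iff)
qed

context graded_modular
begin

lemma extends_norm_le:
  assumes "pisom u" "pisom v" "extends v u"
  shows "norm (u \<xi>) \<le> norm (v \<xi>)"
proof -
  have "(norm (u \<xi>))\<^sup>2 \<le> (norm (v \<xi>))\<^sup>2"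
    using extends_norm[OF assms, of \<xi>] zero_le_power2[of "norm (v \<xi> - u \<xi>)"] by linarith
  then show ?thesis by simp
qed

text \<open>Gluing any \<open>v\<close> to a maximiser \<open>w\<close> raises the squared norm at
  \<open>\<Omega>\<close> by that of \<open>v (1 - p) \<Omega>\<close>, where \<open>p\<close> is
  the support of \<open>w\<close>. Maximality makes this vector zero, and \<open>\<Omega>\<close> is
  separating.\<close>

lemma pisom_greatest:
  obtains w where "pisom w" "\<And>v \<xi>. pisom v \<Longrightarrow> v (support w \<xi>) = v \<xi>"
proof -
  let ?A = "{(norm (blinfun_apply u \<Omega>))\<^sup>2 | u. pisom u}"
  define s where "s = Sup ?A"
  have bdd: "bdd_above ?A"
    using pisom_norm_le by (intro bdd_aboveI[of _ "(norm \<Omega>)\<^sup>2"]) (auto intro: power_mono)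
  have "0 \<in> Z" unfolding Z_iff using M_scale[OF M_id, of 0] M_adj_scale[OF M_id, of 0] by simp
  then have ne: "?A \<noteq> {}" unfolding pisom_def by auto
  have le_s: "(norm (u \<Omega>))\<^sup>2 \<le> s" if "pisom u" for u
    unfolding s_def using bdd that by (intro cSup_upper) auto
  have "\<exists>u. pisom u \<and> s - 1 / real (Suc n) < (norm (u \<Omega>))\<^sup>2" for n
    using less_cSup_iff[OF ne bdd, of "s - 1 / real (Suc n)"] unfolding s_def by auto
  then obtain U where U: "\<And>n. pisom (U n)"
    and U_s: "\<And>n. s - 1 / real (Suc n) < (norm (U n \<Omega>))\<^sup>2" by metis
  \<comment> \<open>A maximising sequence need not converge. Successive joins form a chain of
    extensions that does, and each is at least as large at \<open>\<Omega>\<close> as the member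
    just glued in.\<close>
  define W where "W = rec_nat (U 0) (\<lambda>n w. pisom_join w (U (Suc n)))"
  have W_simps: "W 0 = U 0" "\<And>n. W (Suc n) = pisom_join (W n) (U (Suc n))"
    unfolding W_def by simp_all
  have W: "pisom (W n)" for n
    by (induction n) (auto simp: W_simps U pisom_join_pisom)
  have W_ext: "extends (W m) (W n)" if "n \<le> m" for m n
    using that
  proof (induction m rule: dec_induct)
    case base
    show ?case by (rule extends_refl[OF W])
  next
    case (step m)
    show ?case
      by (rule extends_trans[OF W W step.IH]) (simp add: W_simps extends_join W U)
  qed
  obtain w where w: "w \<in> Z" and lim: "\<And>\<xi>. (\<lambda>n. W n \<xi>) \<longlonglongrightarrow> w \<xi>"
    and lim': "\<And>\<xi>. (\<lambda>n. adj (W n) \<xi>) \<longlonglongrightarrow> adj w \<xi>"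
    using Z_strong_limit[of W] pisom_Z[OF W] pisom_norm_le[OF W] extends_norm[OF W W W_ext]
    by (metis order_refl)
  have "w (adj w (w \<xi>)) = w \<xi>" for \<xi>
  proof -
    have Wc': "norm (adj (W n) \<xi>) \<le> norm \<xi>" for n \<xi>
      using Z_norm_adj[OF pisom_Z[OF W]] pisom_norm_le[OF W] by simp
    have "(\<lambda>n. W n (adj (W n) (W n \<xi>))) \<longlonglongrightarrow> w (adj w (w \<xi>))"
      by (intro lim tendsto_contraction_apply[OF pisom_norm_le[OF W] lim]
          tendsto_contraction_apply[OF Wc' lim'])
    then show ?thesis using lim[of \<xi>] by (simp add: pisom_abs[OF W] LIMSEQ_unique)
  qed
  with w have pw: "pisom w" unfolding pisom_def by blast
  have "norm (U n \<Omega>) \<le> norm (w \<Omega>)" for n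
  proof -
    have "norm (U n \<Omega>) \<le> norm (W n \<Omega>)"
      by (cases n) (auto simp: W_simps norm_join_ge W U)
    also have "\<dots> \<le> norm (w \<Omega>)"
      by (rule LIMSEQ_le_const[OF tendsto_norm[OF lim]], intro exI allI impI)
         (rule extends_norm_le[OF W W W_ext])
    finally show ?thesis .
  qed
  then have "s - 1 / real (Suc n) \<le> (norm (w \<Omega>))\<^sup>2" for n
    using U_s[of n] by (meson less_imp_le norm_ge_zero order_trans power_mono)
  moreover have "(\<lambda>n. s - 1 / real (Suc n)) \<longlonglongrightarrow> s - 0"
    by (intro tendsto_intros LIMSEQ_Suc[OF lim_1_over_n])
  ultimately have s_le: "s - 0 \<le> (norm (w \<Omega>))\<^sup>2" by (intro LIMSEQ_le_const2) auto
  have "v (support w \<xi>) = v \<xi>" if v: "pisom v" for v \<xi>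
  proof -
    have "(norm (v (\<Omega> - support w \<Omega>)))\<^sup>2 \<le> 0"
      using le_s[OF pisom_join_pisom[OF pw v]] s_le norm_join[OF pw v, of \<Omega>]
      by linarith
    then have "(v o\<^sub>L (id_blinfun - support w)) \<Omega> = 0"
      by (simp add: blinfun.diff_left)
    then have "v o\<^sub>L (id_blinfun - support w) = 0"
      using Z_M[OF pisom_Z[OF v]] cp_M[OF central_projection_support[OF pw]]
      by (intro separating M_compose M_diff M_id)
    then show ?thesis by (simp add: blinfun_eq_iff blinfun.bilinear_simps)
  qed
  then show ?thesis using that pw by blast
qed

text \<open>A nonzero element on \<open>1 - p\<close> would, after scaling, have a nonzero polar
  part there; but every partial isometry in \<open>Z\<close> lives on \<open>p\<close>.\<close>

lemma corner_twisted_center_compl_greatest: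
  assumes w: "pisom w" and greatest: "\<And>v \<xi>. pisom v \<Longrightarrow> v (support w \<xi>) = v \<xi>"
  shows "corner_twisted_center J M V (id_blinfun - support w) = {0}"
proof -
  let ?p = "support w"
  note p = central_projection_support[OF w]
  note iff = corner_twisted_center_iff[OF central_projection_compl[OF p]]
  have "x = 0" if x: "x \<in> Z" and px: "\<And>\<xi>. (id_blinfun - ?p) (x \<xi>) = x \<xi>" for x
  proof -
    define y where "y = (1 / (norm x + 1)) *\<^sub>R x"
    have "norm x + 1 > 0" using norm_ge_zero[of x] by linarith
    have contr: "norm (y \<xi>) \<le> norm \<xi>" for \<xi>
    proof -
      have "norm (x \<xi>) \<le> (norm x + 1) * norm \<xi>"
        using add_increasing[OF norm_ge_zero[of \<xi>] norm_blinfun[of x \<xi>]]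
        by (simp add: algebra_simps)
      then show ?thesis
        using \<open>norm x + 1 > 0\<close> unfolding y_def by (simp add: blinfun.scaleR_left field_simps)
    qed
    have y: "y \<in> Z" unfolding y_def by (rule Z_scale[OF x])
    have py: "(id_blinfun - ?p) (y \<xi>) = y \<xi>" for \<xi>
      using px[of \<xi>] unfolding y_def by (simp add: blinfun.bilinear_simps)
    obtain v where v: "pisom v" and vy: "\<And>\<xi>. norm (y \<xi>) \<le> norm (v \<xi>)"
      and pv: "\<And>q \<xi>. q \<in> M \<Longrightarrow> (\<And>\<xi>. blinfun_apply q (y \<xi>) = y \<xi>) \<Longrightarrow> q (v \<xi>) = v \<xi>"
      using pisom_of_contraction[OF y contr] by blast
    have "(id_blinfun - ?p) (v \<xi>) = v \<xi>" for \<xi>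
      using pv[OF M_diff[OF M_id cp_M[OF p]] py] .
    then have "?p (v \<xi>) = 0" for \<xi> by (simp add: blinfun.diff_left)
    then have "v \<xi> = 0" for \<xi>
      using greatest[OF v, of \<xi>] cp_commute[OF p Z_M[OF pisom_Z[OF v]], of \<xi>] by simp
    then have "y \<xi> = 0" for \<xi> using vy[of \<xi>] by simp
    then show "x = 0"
      using \<open>norm x + 1 > 0\<close> unfolding y_def by (simp add: blinfun_eq_iff blinfun.scaleR_left)
  qed
  moreover have "0 \<in> Z" using Z_scale[OF pisom_Z[OF w], of 0] by simp
  ultimately show ?thesis unfolding set_eq_iff iff by (auto simp: blinfun.zero_right)
qed

text \<open>\<open>support w\<close> dominates every admissible projection, so it is the greatest
  one, and a greatest element is the only maximal one.\<close>

lemma maximal_admissible_iff: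
  assumes w: "pisom w" and greatest: "\<And>v \<xi>. pisom v \<Longrightarrow> v (support w \<xi>) = v \<xi>"
  shows "maximal_admissible J M V p \<longleftrightarrow> p = support w"
proof -
  have proj: "is_projection q" if "admissible J M V q" for q
    using that unfolding admissible_def by blast
  have adm: "admissible J M V (support w)" using w admissible_iff by blast
  have le: "q o\<^sub>L support w = q \<and> support w o\<^sub>L q = q" if "admissible J M V q" for q
  proof -
    from that obtain v where v: "pisom v" "q = support v" unfolding admissible_iff by blast
    have "q (support w \<xi>) = q \<xi>" for \<xi> unfolding v(2) support_def[of v] by (simp add: greatest v(1))
    then show ?thesis
      using cp_commute[OF central_projection_support[OF w] cp_M[OF central_projection_support[OF v(1)]]]
      by (simp add: blinfun_eq_iff v(2))
  qed
  show ?thesis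
  proof
    assume "maximal_admissible J M V p"
    then have "admissible J M V p"
      and max: "\<And>q. admissible J M V q \<Longrightarrow> projection_le p q \<Longrightarrow> q = p"
      unfolding maximal_admissible_def by blast+
    from max[OF adm] le[OF this(1)] show "p = support w"
      by (simp add: projection_le_iff[OF proj[OF adm]])
  next
    assume p: "p = support w"
    have "q = p" if q: "admissible J M V q" "projection_le p q" for q
      using le[OF q(1)] q(2) unfolding projection_le_iff[OF proj[OF q(1)]] p by simp
    then show "maximal_admissible J M V p"
      unfolding maximal_admissible_def using adm p by blast
  qed
qed

text \<open>\<open>J u J = V (adj u)\<close> reduces the right side to \<open>u V (adj u)\<close>,
  and the intertwining rule for \<open>adj u\<close> moves \<open>V\<close> to the front, leaving
  \<open>V (adj u) u\<close>.\<close>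

lemma corner_V_eq:
  assumes u: "pisom u"
  shows "corner (support u) V = u o\<^sub>L J o\<^sub>L u o\<^sub>L J"
proof (rule blinfun_eqI)
  fix \<xi>
  note p = central_projection_support[OF u] and uM = Z_M[OF pisom_Z[OF u]]
  have "u (J (u (J \<xi>))) = u (V (adj u \<xi>))" by (simp add: Z_J pisom_Z u)
  also have "\<dots> = V (V (u (V (adj u \<xi>))))" by simp
  also have "\<dots> = V (adj u (u \<xi>))" using Z_adj_intertwines[OF pisom_Z[OF u] uM, of \<xi>] by simp
  finally show "corner (support u) V \<xi> = (u o\<^sub>L J o\<^sub>L u o\<^sub>L J) \<xi>"
    unfolding corner_def by (simp add: cp_V[OF p] cp_idem[OF p] flip: cp_V[OF p]) (simp add: support_def)
qed

lemma twisted_center_decomposition: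
  assumes p: "central_projection p"
  shows "Z = op_sum (corner_twisted_center J M V p) (corner_twisted_center J M V (id_blinfun - p))"
proof (intro set_eqI iffI)
  note iffs = corner_twisted_center_iff[OF p] corner_twisted_center_iff[OF central_projection_compl[OF p]]
  fix x assume x: "x \<in> Z"
  have "x o\<^sub>L p \<in> corner_twisted_center J M V p"
    unfolding iffs using Z_compose_central[OF x cp_center[OF p]]
    by (simp add: cp_commute[OF p Z_M[OF x]] cp_idem[OF p])
  moreover have "x o\<^sub>L (id_blinfun - p) \<in> corner_twisted_center J M V (id_blinfun - p)"
    unfolding iffs
    using Z_compose_central[OF x cp_center[OF central_projection_compl[OF p]]]
    by (simp add: blinfun.bilinear_simps cp_commute[OF p Z_M[OF x]] cp_idem[OF p])
  moreover have "x = (x o\<^sub>L p) + (x o\<^sub>L (id_blinfun - p))"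
    by (simp add: blinfun_eq_iff blinfun.bilinear_simps)
  ultimately show
    "x \<in> op_sum (corner_twisted_center J M V p) (corner_twisted_center J M V (id_blinfun - p))"
    unfolding op_sum_def by blast
qed (auto simp: op_sum_def corner_twisted_center_iff[OF p]
      corner_twisted_center_iff[OF central_projection_compl[OF p]] intro: Z_add)

text \<open>The coefficient of \<open>x\<close> is \<open>adj u o\<^sub>L x\<close>, central as a
  product of this shape; \<open>u (adj u)\<close> is the support and acts trivially on
  \<open>x\<close>.\<close>

lemma corner_twisted_center_eq:
  assumes u: "pisom u"
  shows "corner_twisted_center J M V (support u) =
    {u o\<^sub>L z | z. z \<in> center (corner (support u) ` M)}"
proof (intro set_eqI iffI)
  note p = central_projection_support[OF u] and uM = Z_M[OF pisom_Z[OF u]]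
  note iffs = corner_twisted_center_iff[OF p] center_corner_iff[OF p]
  fix x
  {
    assume "x \<in> corner_twisted_center J M V (support u)"
    then have x: "x \<in> Z" and px: "support u (x \<xi>) = x \<xi>" for \<xi> unfolding iffs by auto
    have "support u (adj u (x \<xi>)) = adj u (x \<xi>)" for \<xi>
      using cp_commute[OF p M_adj[OF uM], of "x \<xi>"] px by simp
    then have "adj u o\<^sub>L x \<in> center (corner (support u) ` M)"
      unfolding iffs using Z_abs_central[OF pisom_Z[OF u] x] by simp
    moreover have "x = u o\<^sub>L (adj u o\<^sub>L x)"
    proof (rule blinfun_eqI)
      fix \<xi>
      have "u (adj u (x \<xi>)) = support u (x \<xi>)"
        unfolding support_def by (simp add: Z_normal pisom_Z u)
      then show "x \<xi> = (u o\<^sub>L (adj u o\<^sub>L x)) \<xi>" using px by simp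
    qed
    ultimately show "x \<in> {u o\<^sub>L z | z. z \<in> center (corner (support u) ` M)}" by blast
  next
    assume "x \<in> {u o\<^sub>L z | z. z \<in> center (corner (support u) ` M)}"
    then obtain z where z: "z \<in> center M" and x: "x = u o\<^sub>L z" unfolding iffs by blast
    show "x \<in> corner_twisted_center J M V (support u)"
      unfolding iffs x using Z_compose_central[OF pisom_Z[OF u] z] by (simp add: support_left u)
  }
qed

end

theorem theorem2p13:
  fixes M :: "('a::complex_hilbert \<Rightarrow>\<^sub>L 'a) set"
    and \<Omega> :: 'a
    and V J :: "'a \<Rightarrow>\<^sub>L 'a"
  assumes "graded_von_neumann_algebra M \<Omega> V"
    and "modular_conjugation M \<Omega> J"
  shows "(\<exists>!p. maximal_admissible J M V p) \<and>
    (\<forall>p u. maximal_admissible J M V p \<and> twisted_unitary J M V p u \<longrightarrow>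
       corner p V = u o\<^sub>L J o\<^sub>L u o\<^sub>L J \<and>
       twisted_center J M V =
         op_sum (corner_twisted_center J M V p) (corner_twisted_center J M V (id_blinfun - p)) \<and>
       op_sum (corner_twisted_center J M V p) (corner_twisted_center J M V (id_blinfun - p)) =
         op_sum {u o\<^sub>L z | z. z \<in> center (corner p ` M)} {0})"
proof -
  obtain R where "antiunitary J" "positive_selfadjoint R"
    "tomita_operator M \<Omega> = {(x, J w) | x w. (x, w) \<in> R}"
    using assms(2) unfolding modular_conjugation_def by blast
  then interpret graded_modular M \<Omega> V J R
    using assms(1) by unfold_locales
  obtain w where w: "pisom w" and greatest: "\<And>v \<xi>. pisom v \<Longrightarrow> v (support w \<xi>) = v \<xi>"
    using pisom_greatest by blast
  note max = maximal_admissible_iff[OF w greatest]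
  have "corner p V = u o\<^sub>L J o\<^sub>L u o\<^sub>L J \<and>
       Z = op_sum (corner_twisted_center J M V p) (corner_twisted_center J M V (id_blinfun - p)) \<and>
       op_sum (corner_twisted_center J M V p) (corner_twisted_center J M V (id_blinfun - p)) =
         op_sum {u o\<^sub>L z | z. z \<in> center (corner p ` M)} {0}"
    if "maximal_admissible J M V p" and unitary: "twisted_unitary J M V p u" for p u
  proof -
    have p: "p = support w" using that max by blast
    note cp = central_projection_support[OF w, folded p]
    \<comment> \<open>\<open>u\<close> may differ from \<open>w\<close>; only the equality of their
      supports matters, so the structural lemmas are applied to \<open>u\<close> and maximality to
      \<open>w\<close>.\<close>
    note u = twisted_unitaryD[OF cp unitary]
    show ?thesis
      using corner_V_eq[OF u(1)] twisted_center_decomposition[OF cp] corner_twisted_center_eq[OF u(1)]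
        corner_twisted_center_compl_greatest[OF w greatest, folded p]
      by (simp add: u(2))
  qed
  then show ?thesis using max by auto
qed

end
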